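(* Let $X\subset\mathbb{P}^4$ be a cubic threefold over $\mathbb{R}$ such that $X_{\mathbb{C}}$ has $6\mathsf{A}_1$-singularities and contains exactly one plane. Then $X$ is rational over $\mathbb{R}$.
   Context: $X_{\mathbb{C}}$ denotes the base change of $X$ to $\mathbb{C}$. "$X_{\mathbb{C}}$ has $6\mathsf{A}_1$-singularities" means that its singular locus consists of exactly six ordinary double points. *)

theory Defs
  imports "HOL-Analysis.Analysis" "HOL-Library.Poly_Mapping" "HOL-Library.Numeral_Type"
    "HOL-Computational_Algebra.Factorial_Ring"
begin

section \<open>Polynomials in finitely many variables\<close>

text \<open>
  A polynomial is a finitely supported map from exponent vectors to coefficients;
  its ring structure is the one of \<^theory>\<open>HOL-Library.Poly_Mapping\<close>. The
  variables are indexed by a finite type \<open>'v\<close>.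
\<close>

type_synonym ('v, 'a) mpoly = "('v \<Rightarrow>\<^sub>0 nat) \<Rightarrow>\<^sub>0 'a"

definition Const :: "'a::zero \<Rightarrow> ('v, 'a) mpoly" where
  "Const c = Poly_Mapping.single 0 c"

definition Var :: "'v \<Rightarrow> ('v, 'a::zero_neq_one) mpoly" where
  "Var i = Poly_Mapping.single (Poly_Mapping.single i 1) 1"

definition eval_hom ::
    "('a::zero \<Rightarrow> 'b::comm_semiring_1) \<Rightarrow> ('v::finite \<Rightarrow> 'b) \<Rightarrow> ('v, 'a) mpoly \<Rightarrow> 'b" where
  "eval_hom \<theta> x p =
     (\<Sum>m\<in>Poly_Mapping.keys p.
        \<theta> (Poly_Mapping.lookup p m) * (\<Prod>i\<in>UNIV. x i ^ Poly_Mapping.lookup m i))"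

definition eval_at :: "('v::finite, 'a::field) mpoly \<Rightarrow> 'a ^ 'v \<Rightarrow> 'a" where
  "eval_at p x = eval_hom id (\<lambda>i. x $ i) p"

definition subst_poly ::
    "('v::finite \<Rightarrow> ('w, 'a::field) mpoly) \<Rightarrow> ('v, 'a) mpoly \<Rightarrow> ('w, 'a) mpoly" where
  "subst_poly \<phi> p = eval_hom Const \<phi> p"

definition pderiv_at :: "'v \<Rightarrow> ('v, 'a::field) mpoly \<Rightarrow> ('v, 'a) mpoly" where
  "pderiv_at i p =
     (\<Sum>m\<in>Poly_Mapping.keys p.
        Poly_Mapping.single (m - Poly_Mapping.single i 1)
          (of_nat (Poly_Mapping.lookup m i) * Poly_Mapping.lookup p m))"

definition homogeneous :: "nat \<Rightarrow> ('v::finite, 'a::zero) mpoly \<Rightarrow> bool" where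
  "homogeneous d p \<longleftrightarrow>
     (\<forall>m\<in>Poly_Mapping.keys p. (\<Sum>i\<in>UNIV. Poly_Mapping.lookup m i) = d)"

text \<open>The equation over the complex numbers of the base change of a real hypersurface.\<close>

definition complexify :: "('v, real) mpoly \<Rightarrow> ('v, complex) mpoly" where
  "complexify p = Poly_Mapping.map complex_of_real p"


section \<open>Projective hypersurfaces\<close>

text \<open>
  The projective space with homogeneous coordinates indexed by \<open>'v\<close> has dimension
  \<open>CARD('v) - 1\<close>. Its linear subspaces of dimension \<open>d\<close> (points for \<open>d = 0\<close>, planes
  for \<open>d = 2\<close>) are given by the vector subspaces of dimension \<open>d + 1\<close>.
\<close>

definition proj_subspaces :: "nat \<Rightarrow> ('a::field ^ 'v::finite) set set" where
  "proj_subspaces d = {W. vec.subspace W \<and> vec.dim W = d + 1}"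

text \<open>The linear subspaces of dimension \<open>d\<close> contained in the hypersurface \<open>F = 0\<close>.\<close>

definition linear_subspaces_in :: "('v::finite, 'a::field) mpoly \<Rightarrow> nat \<Rightarrow> ('a ^ 'v) set set" where
  "linear_subspaces_in F d = {W \<in> proj_subspaces d. \<forall>x\<in>W. eval_at F x = 0}"

definition singular_points :: "('v::finite, 'a::field) mpoly \<Rightarrow> ('a ^ 'v) set set" where
  "singular_points F =
     {L \<in> proj_subspaces 0. \<forall>x\<in>L. eval_at F x = 0 \<and> (\<forall>i. eval_at (pderiv_at i F) x = 0)}"

text \<open>
  An ordinary double point (singularity of type \<open>A\<^sub>1\<close>) is a singular point whose local
  equation has a nondegenerate Hessian. The local equation is taken in an affine chart
  \<open>x\<^sub>i = 1\<close> containing the point, with coordinates \<open>x\<^sub>j\<close> for \<open>j \<noteq> i\<close>; its tangent space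
  consists of the vectors \<open>v\<close> with \<open>v\<^sub>i = 0\<close>. The choice of \<open>i\<close> is immaterial.
\<close>

definition ordinary_double_point :: "('v::finite, 'a::field) mpoly \<Rightarrow> ('a ^ 'v) set \<Rightarrow> bool" where
  "ordinary_double_point F L \<longleftrightarrow>
     L \<in> singular_points F \<and>
     (\<exists>i. \<exists>x\<in>L. x $ i = 1 \<and>
        (\<forall>v. v $ i = 0 \<and>
             (\<forall>j. j \<noteq> i \<longrightarrow> (\<Sum>k\<in>UNIV. eval_at (pderiv_at j (pderiv_at k F)) x * v $ k) = 0)
           \<longrightarrow> v = 0))"

definition has_six_A1_singularities :: "('v::finite, 'a::field) mpoly \<Rightarrow> bool" where
  "has_six_A1_singularities F \<longleftrightarrow>
     card (singular_points F) = 6 \<and> (\<forall>L\<in>singular_points F. ordinary_double_point F L)"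


section \<open>Rational maps and rationality\<close>

text \<open>
  In this section \<open>F\<close> and \<open>G\<close> are homogeneous and either irreducible or \<open>0\<close>, the latter
  standing for the whole projective space. The homogeneous coordinate ring of \<open>F = 0\<close> is the
  polynomial ring modulo \<open>F\<close>, so that a polynomial vanishes on \<open>F = 0\<close> iff \<open>F\<close> divides it
  (\<open>0\<close> divides only \<open>0\<close>).

  A rational map defined over the ground field is given by a tuple of homogeneous polynomials
  of the same degree with coefficients in that field, not all vanishing on the source. Two
  tuples define the same map iff they are proportional on the source.
\<close>

definition rational_map ::
    "('v::finite, 'a::field) mpoly \<Rightarrow> ('w::finite, 'a) mpoly \<Rightarrow> ('w \<Rightarrow> ('v, 'a) mpoly) \<Rightarrow> bool" where
  "rational_map F G \<phi> \<longleftrightarrow>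
     (\<exists>d. \<forall>i. homogeneous d (\<phi> i)) \<and>
     (\<exists>i. \<not> F dvd \<phi> i) \<and>
     F dvd subst_poly \<phi> G"

definition same_rational_map ::
    "('v, 'a::field) mpoly \<Rightarrow> ('w \<Rightarrow> ('v, 'a) mpoly) \<Rightarrow> ('w \<Rightarrow> ('v, 'a) mpoly) \<Rightarrow> bool" where
  "same_rational_map F \<phi> \<psi> \<longleftrightarrow> (\<forall>i j. F dvd \<phi> i * \<psi> j - \<phi> j * \<psi> i)"

text \<open>\<open>comp_map \<psi> \<phi>\<close> represents \<open>\<psi>\<close> after \<open>\<phi>\<close>, provided it does not vanish on the source of \<open>\<phi>\<close>.\<close>

definition comp_map ::
    "('u \<Rightarrow> ('w::finite, 'a::field) mpoly) \<Rightarrow> ('w \<Rightarrow> ('v, 'a) mpoly) \<Rightarrow> 'u \<Rightarrow> ('v, 'a) mpoly" where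
  "comp_map \<psi> \<phi> = (\<lambda>i. subst_poly \<phi> (\<psi> i))"

definition rational_inverse ::
    "('v::finite, 'a::field) mpoly \<Rightarrow> ('w::finite \<Rightarrow> ('v, 'a) mpoly) \<Rightarrow>
       ('v \<Rightarrow> ('w, 'a) mpoly) \<Rightarrow> bool" where
  "rational_inverse F \<phi> \<psi> \<longleftrightarrow>
     (\<exists>i. \<not> F dvd comp_map \<psi> \<phi> i) \<and> same_rational_map F (comp_map \<psi> \<phi>) Var"

definition birational :: "('v::finite, 'a::field) mpoly \<Rightarrow> ('w::finite, 'a) mpoly \<Rightarrow> bool" where
  "birational F G \<longleftrightarrow>
     (\<exists>\<phi> \<psi>. rational_map F G \<phi> \<and> rational_map G F \<psi> \<and>
        rational_inverse F \<phi> \<psi> \<and> rational_inverse G \<psi> \<phi>)"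

text \<open>
  A rational variety is in particular integral, which for a hypersurface means that its
  equation is irreducible over the ground field.
\<close>

definition rational_threefold :: "(5, 'a::field) mpoly \<Rightarrow> bool" where
  "rational_threefold F \<longleftrightarrow> irreducible F \<and> birational F (0 :: (4, 'a) mpoly)"

end

theory Submission
  imports Defs "HOL-Computational_Algebra.Polynomial"
begin

text \<open>
  All geometry is expressed through the symmetric trilinear form \<open>T\<close> with \<open>F x = T x x x\<close>: a point \<open>x\<close> is
  singular iff \<open>T x x y = 0\<close> for all \<open>y\<close>. The unique plane \<open>W\<close> is stable under conjugation, hence
  real. Two conics in \<open>W\<close> meeting in finitely many points meet in at most four, so some node \<open>p\<close>
  lies off \<open>W\<close>. If \<open>p\<close> is real, projection from \<open>p\<close> is birational. Otherwise the line through \<open>p\<close>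
  and its conjugate is real and contained in the cubic, and it misses \<open>W\<close>, since otherwise the cubic
  would contain a second plane. Over the reals the projection from \<open>W\<close> makes the cubic a family of
  quadric surfaces over the projective line, and the line is a section of it, which gives a
  parametrization. Irreducibility holds because a reducible cubic form has a linear factor, whose
  hyperplane contains many planes.
\<close>

section \<open>Evaluation of polynomials\<close>

text \<open>The obstacle is that no real node need exist; a conjugate pair of nodes p, q replaces
  it. The line through p and q lies in the cubic because every term of T on it contains p or q
  twice. That it misses the plane means that two vectors of the line and three of the plane form a
  basis of the whole space. In this basis the cubic has no pure terms: for P on the line and w in
  the plane, F (P + w) = 3 T P P w + 3 T P w w. The parametrization needs both summands to be
  nonzero; if one vanished identically, the line or the plane would consist of singular points.
  Likewise, a node v with T v w w = 0 for all w would be the vertex of a cone, and its join with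
  another node would be a singular line. So five singular points give one off the plane, and two
  exclude the cone. Uniqueness of the plane is used three times: for its descent to the reals, for
  the position of the line, and for irreducibility.

  Birationality is checked on explicit tuples of forms: one composite is a common factor times the
  identity, the other is proportional to the identity modulo F.\<close>

lemma mpoly_sum_monomials:
  "(\<Sum>m\<in>Poly_Mapping.keys p. Poly_Mapping.single m (Poly_Mapping.lookup p m)) = p"
  by (rule poly_mapping_eqI)
     (auto simp: lookup_sum lookup_single when_def in_keys_iff sum.delta)

lemma mpoly_induct [case_names single add]:
  assumes "\<And>m a. P (Poly_Mapping.single m a)" "\<And>p q. P p \<Longrightarrow> P q \<Longrightarrow> P (p + q)"
  shows "P (p :: 'm \<Rightarrow>\<^sub>0 'a::comm_monoid_add)"
proof -
  have "P (\<Sum>m\<in>A. Poly_Mapping.single m (Poly_Mapping.lookup p m))" if "finite A" for A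
    using that
  proof induction
    case empty
    show ?case using assms(1)[of undefined 0] by simp
  qed (simp add: assms)
  from this[of "Poly_Mapping.keys p"] show ?thesis by (simp add: mpoly_sum_monomials)
qed

text \<open>Used on two levels: for coefficient maps such as \<open>id\<close>, \<open>Const\<close>
  and \<open>cnj\<close>, and again for the evaluations and substitutions that they induce. Facts
  about \<open>tri\<close> proved here thus serve evaluation, substitution, complexification and
  conjugation alike.\<close>

locale coeff_hom =
  fixes \<theta> :: "'a::comm_ring_1 \<Rightarrow> 'b::comm_ring_1"
  assumes zero [simp]: "\<theta> 0 = 0" and one [simp]: "\<theta> 1 = 1"
    and add: "\<theta> (a + b) = \<theta> a + \<theta> b" and mult: "\<theta> (a * b) = \<theta> a * \<theta> b"
begin

lemma uminus: "\<theta> (- a) = - \<theta> a"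
  using add[of "- a" a] by (simp add: eq_neg_iff_add_eq_0)

lemma diff: "\<theta> (a - b) = \<theta> a - \<theta> b"
  using add[of a "- b"] by (simp add: uminus)

lemma sum: "\<theta> (sum f A) = (\<Sum>i\<in>A. \<theta> (f i))"
  by (induction A rule: infinite_finite_induct) (auto simp: add)

lemma eval_hom_superset:
  assumes "finite S" "Poly_Mapping.keys p \<subseteq> S"
  shows "eval_hom \<theta> x p =
    (\<Sum>m\<in>S. \<theta> (Poly_Mapping.lookup p m) * (\<Prod>i\<in>UNIV. x i ^ Poly_Mapping.lookup m i))"
  unfolding eval_hom_def using assms by (intro sum.mono_neutral_left) (auto simp: in_keys_iff)

lemma eval_hom_single:
  "eval_hom \<theta> x (Poly_Mapping.single m a) = \<theta> a * (\<Prod>i\<in>UNIV. x i ^ Poly_Mapping.lookup m i)"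
  using eval_hom_superset[of "{m}" "Poly_Mapping.single m a"] by simp

lemma eval_hom_0 [simp]: "eval_hom \<theta> x 0 = 0"
  by (simp add: eval_hom_def)

lemma eval_hom_add: "eval_hom \<theta> x (p + q) = eval_hom \<theta> x p + eval_hom \<theta> x q"
proof -
  let ?S = "Poly_Mapping.keys p \<union> Poly_Mapping.keys q"
  have "Poly_Mapping.keys (p + q) \<subseteq> ?S" by (rule keys_add)
  then show ?thesis
    by (simp add: eval_hom_superset[of ?S] lookup_add add distrib_right sum.distrib)
qed

lemma eval_hom_mult: "eval_hom \<theta> x (p * q) = eval_hom \<theta> x p * eval_hom \<theta> x q"
proof (induction p rule: mpoly_induct)
  case (single m a)
  show ?case
  proof (induction q rule: mpoly_induct)
    case (single n b)
    show ?case
      by (simp add: mult_single eval_hom_single mult lookup_add power_add prod.distrib mult_ac)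
  qed (simp add: eval_hom_add distrib_left)
qed (simp add: eval_hom_add distrib_right)

lemma eval_hom_Const [simp]: "eval_hom \<theta> x (Const a) = \<theta> a"
  by (simp add: Const_def eval_hom_single)

lemma eval_hom_Var [simp]: "eval_hom \<theta> x (Var i) = x i"
proof -
  have "(\<Prod>j\<in>UNIV. x j ^ Poly_Mapping.lookup (Poly_Mapping.single i (1::nat)) j)
      = (\<Prod>j\<in>UNIV. if j = i then x i else 1)"
    by (intro prod.cong) (auto simp: lookup_single when_def)
  then show ?thesis by (simp add: Var_def eval_hom_single)
qed

lemma coeff_hom_eval_hom: "coeff_hom (eval_hom \<theta> x)"
proof
  show "eval_hom \<theta> x 1 = 1" 
    using eval_hom_Const[of x 1] by (simp add: Const_def)
qed (simp_all add: eval_hom_add eval_hom_mult)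

end

lemma coeff_hom_Const: "coeff_hom (Const :: 'a::comm_ring_1 \<Rightarrow> ('v, 'a) mpoly)"
  by standard (simp_all add: Const_def single_add mult_single)

interpretation Const: coeff_hom "Const :: 'a::comm_ring_1 \<Rightarrow> ('v, 'a) mpoly"
  by (rule coeff_hom_Const)

interpretation id: coeff_hom "id :: 'a::comm_ring_1 \<Rightarrow> 'a"
  by standard auto

interpretation of_real: coeff_hom complex_of_real
  by standard auto

interpretation subst_poly: coeff_hom "subst_poly \<phi>"
  unfolding subst_poly_def by (rule Const.coeff_hom_eval_hom)

interpretation eval_at: coeff_hom "\<lambda>p. eval_at p x"
  unfolding eval_at_def by (rule id.coeff_hom_eval_hom)

lemma subst_poly_Var [simp]: "subst_poly \<phi> (Var i) = \<phi> i"
  by (simp add: subst_poly_def)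

lemma subst_poly_Const [simp]: "subst_poly \<phi> (Const a) = Const a"
  by (simp add: subst_poly_def)

lemma Const_eq_0_iff [simp]: "Const a = 0 \<longleftrightarrow> a = 0"
  by (metis Const_def lookup_single_eq lookup_zero single_zero)

section \<open>Homogeneous polynomials\<close>

lemma homogeneous_0 [simp]: "homogeneous d 0"
  by (simp add: homogeneous_def)

lemma homogeneous_single:
  "(\<Sum>i\<in>UNIV. Poly_Mapping.lookup m i) = d \<Longrightarrow> homogeneous d (Poly_Mapping.single m a)"
  by (simp add: homogeneous_def)

lemma homogeneous_Const: "homogeneous 0 (Const a)"
  unfolding Const_def by (rule homogeneous_single) simp

lemma homogeneous_Var: "homogeneous 1 (Var i)"
  unfolding Var_def by (rule homogeneous_single) (simp add: lookup_single when_def)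

lemma homogeneous_add: "homogeneous d p \<Longrightarrow> homogeneous d q \<Longrightarrow> homogeneous d (p + q)"
  using keys_add[of p q] by (fastforce simp: homogeneous_def)

lemma homogeneous_uminus: "homogeneous d p \<Longrightarrow> homogeneous d (- p :: ('v::finite, 'a::ring_1) mpoly)"
  by (simp add: homogeneous_def)

lemma homogeneous_sum: "(\<And>i. i \<in> A \<Longrightarrow> homogeneous d (f i)) \<Longrightarrow> homogeneous d (sum f A)"
  by (induction A rule: infinite_finite_induct) (auto intro: homogeneous_add)

lemma homogeneous_mult:
  "homogeneous d p \<Longrightarrow> homogeneous e q \<Longrightarrow> homogeneous (d + e) (p * q)"
  using keys_mult[of p q] by (fastforce simp: homogeneous_def lookup_add sum.distrib)

lemma homogeneous_Const_mult: "homogeneous d p \<Longrightarrow> homogeneous d (Const a * p)"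
  using homogeneous_mult[OF homogeneous_Const] by fastforce

lemma exponent_split:
  fixes m :: "'v::finite \<Rightarrow>\<^sub>0 nat"
  assumes "(\<Sum>i\<in>UNIV. Poly_Mapping.lookup m i) = Suc d"
  obtains i n where "m = Poly_Mapping.single i 1 + n" "(\<Sum>i\<in>UNIV. Poly_Mapping.lookup n i) = d"
proof -
  obtain i where i: "Poly_Mapping.lookup m i \<noteq> 0"
    using assms by (metis sum.neutral nat.distinct(1))
  define n where "n = m - Poly_Mapping.single i 1"
  have m: "m = Poly_Mapping.single i 1 + n"
    using i by (intro poly_mapping_eqI) (auto simp: n_def lookup_add lookup_minus lookup_single when_def)
  then have "(\<Sum>i\<in>UNIV. Poly_Mapping.lookup n i) = d"
    using assms by (simp add: lookup_add sum.distrib lookup_single when_def)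
  with m show ?thesis by (rule that)
qed

lemma exponent_zero:
  fixes m :: "'v::finite \<Rightarrow>\<^sub>0 nat"
  assumes "(\<Sum>i\<in>UNIV. Poly_Mapping.lookup m i) = 0"
  shows "m = 0"
  using assms by (intro poly_mapping_eqI) simp

lemma homogeneous_0_imp_Const:
  assumes "homogeneous 0 p"
  obtains a where "p = Const a"
proof -
  have "Poly_Mapping.keys p \<subseteq> {0}"
    using assms exponent_zero unfolding homogeneous_def by blast
  then have "p = Const (Poly_Mapping.lookup p 0)"
    unfolding Const_def by (intro poly_mapping_eqI) (auto simp: lookup_single when_def in_keys_iff)
  then show ?thesis by (rule that)
qed

lemma homogeneous_1_imp_linear:
  fixes p :: "('v::finite, 'a::comm_ring_1) mpoly"
  assumes "homogeneous 1 p"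
  obtains l where "p = (\<Sum>i\<in>UNIV. Const (l i) * Var i)"
proof -
  have "\<exists>l. (\<Sum>m\<in>A. Poly_Mapping.single m (Poly_Mapping.lookup p m)) = (\<Sum>i\<in>UNIV. Const (l i) * Var i)"
    if "finite A" "A \<subseteq> Poly_Mapping.keys p" for A
    using that
  proof induction
    case empty
    show ?case by (intro exI[of _ "\<lambda>_. 0"]) simp
  next
    case (insert m A)
    then obtain l where l: "(\<Sum>m\<in>A. Poly_Mapping.single m (Poly_Mapping.lookup p m))
        = (\<Sum>i\<in>UNIV. Const (l i) * Var i)" by auto
    from insert.prems assms have "(\<Sum>i\<in>UNIV. Poly_Mapping.lookup m i) = Suc 0"
      by (simp add: homogeneous_def)
    then obtain j where "m = Poly_Mapping.single j 1"
      by (metis exponent_split exponent_zero add.right_neutral)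
    then have "Poly_Mapping.single m (Poly_Mapping.lookup p m)
        = (\<Sum>i\<in>UNIV. Const (if i = j then Poly_Mapping.lookup p m else 0) * Var i)"
      by (simp add: if_distrib[of Const] if_distrib[of "\<lambda>x. x * _"] sum.delta cong: if_cong)
         (simp add: Const_def Var_def mult_single)
    then show ?case using insert.hyps l
      by (intro exI[of _ "\<lambda>i. (if i = j then Poly_Mapping.lookup p m else 0) + l i"])
         (simp add: Const.add distrib_right sum.distrib)
  qed
  from this[of "Poly_Mapping.keys p"] show ?thesis using that by (auto simp: mpoly_sum_monomials)
qed

section \<open>Cubic forms and their polarization\<close>

text \<open>The arguments are functions so that their entries may be polynomials: with
  \<open>Var\<close> in every slot this is the cubic polynomial itself, with a tuple of forms it is
  the result of substituting a parametrization.\<close>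

definition tri :: "('v \<Rightarrow> 'v \<Rightarrow> 'v \<Rightarrow> 'a) \<Rightarrow> ('v::finite \<Rightarrow> 'a) \<Rightarrow> ('v \<Rightarrow> 'a) \<Rightarrow> ('v \<Rightarrow> 'a) \<Rightarrow> 'a::comm_ring_1"
  where "tri c x y z = (\<Sum>i\<in>UNIV. \<Sum>j\<in>UNIV. \<Sum>k\<in>UNIV. c i j k * x i * y j * z k)"

definition symmetric_array :: "('v \<Rightarrow> 'v \<Rightarrow> 'v \<Rightarrow> 'a) \<Rightarrow> bool"
  where "symmetric_array c \<longleftrightarrow> (\<forall>i j k. c j i k = c i j k \<and> c i k j = c i j k)"

abbreviation cubic_form :: "('v::finite \<Rightarrow> 'v \<Rightarrow> 'v \<Rightarrow> 'a) \<Rightarrow> ('v, 'a::comm_ring_1) mpoly"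
  where "cubic_form c \<equiv> tri (\<lambda>i j k. Const (c i j k)) Var Var Var"

lemma sum_swap12: "(\<Sum>i\<in>A. \<Sum>j\<in>A. h i j) = (\<Sum>i\<in>A. \<Sum>j\<in>A. h j i)"
  by (rule sum.swap)

lemma sum_swap23:
  "(\<Sum>i\<in>A. \<Sum>j\<in>B. \<Sum>k\<in>B. h i j k) = (\<Sum>i\<in>A. \<Sum>j\<in>B. \<Sum>k\<in>B. h i k j)"
  by (rule sum.cong[OF refl], rule sum.swap)

lemma tri_swap12: "symmetric_array c \<Longrightarrow> tri c x y z = tri c y x z"
  unfolding tri_def
  by (subst sum_swap12) (simp add: symmetric_array_def mult.commute mult.left_commute)

lemma tri_swap23: "symmetric_array c \<Longrightarrow> tri c x y z = tri c x z y"
  unfolding tri_def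
  by (subst sum_swap23) (simp add: symmetric_array_def mult.commute mult.left_commute)

lemma tri_add1: "tri c (\<lambda>i. x i + x' i) y z = tri c x y z + tri c x' y z"
  by (simp add: tri_def algebra_simps sum.distrib)
lemma tri_add2: "tri c x (\<lambda>i. y i + y' i) z = tri c x y z + tri c x y' z"
  by (simp add: tri_def algebra_simps sum.distrib)
lemma tri_add3: "tri c x y (\<lambda>i. z i + z' i) = tri c x y z + tri c x y z'"
  by (simp add: tri_def algebra_simps sum.distrib)
lemma tri_scale1: "tri c (\<lambda>i. a * x i) y z = a * tri c x y z"
  by (simp add: tri_def sum_distrib_left mult_ac)
lemma tri_scale2: "tri c x (\<lambda>i. a * y i) z = a * tri c x y z"
  by (simp add: tri_def sum_distrib_left mult_ac)
lemma tri_scale3: "tri c x y (\<lambda>i. a * z i) = a * tri c x y z"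
  by (simp add: tri_def sum_distrib_left mult_ac)

lemmas tri_linear = tri_add1 tri_add2 tri_add3 tri_scale1 tri_scale2 tri_scale3

lemma (in coeff_hom) tri:
  "\<theta> (tri c x y z) = tri (\<lambda>i j k. \<theta> (c i j k)) (\<lambda>i. \<theta> (x i)) (\<lambda>i. \<theta> (y i)) (\<lambda>i. \<theta> (z i))"
  by (simp add: tri_def sum mult)

lemma (in coeff_hom) eval_hom_cubic_form:
  "eval_hom \<theta> x (cubic_form c) = tri (\<lambda>i j k. \<theta> (c i j k)) x x x"
  by (subst coeff_hom.tri[OF coeff_hom_eval_hom]) simp

text \<open>A monomial of degree three is a product of three variables, which yields some array of
  coefficients. Averaging over the six permutations of the indices makes the array symmetric and
  leaves the form unchanged; dividing by 6 is where characteristic zero enters.\<close>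

lemma homogeneous_3_imp_cubic_form:
  fixes F :: "('v::finite, 'a::field_char_0) mpoly"
  assumes "homogeneous 3 F"
  obtains c where "symmetric_array c" "F = cubic_form c"
proof -
  have "\<exists>c. (\<Sum>m\<in>A. Poly_Mapping.single m (Poly_Mapping.lookup F m)) = cubic_form c"
    if "finite A" "A \<subseteq> Poly_Mapping.keys F" for A
    using that
  proof induction
    case empty
    show ?case by (intro exI[of _ "\<lambda>_ _ _. 0"]) (simp add: tri_def)
  next
    case (insert m A)
    then obtain c where c: "(\<Sum>m\<in>A. Poly_Mapping.single m (Poly_Mapping.lookup F m)) = cubic_form c"
      by auto
    from insert.prems assms have "(\<Sum>i\<in>UNIV. Poly_Mapping.lookup m i) = Suc (Suc (Suc 0))"
      by (simp add: homogeneous_def)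
    then obtain i j k where m: "m = Poly_Mapping.single i 1 + (Poly_Mapping.single j 1 + Poly_Mapping.single k 1)"
      by (metis exponent_split exponent_zero add.right_neutral)
    let ?a = "Poly_Mapping.lookup F m"
    \<comment> \<open>The array with a single entry. The test on the innermost summation index
      stands outermost, so that \<open>sum.delta\<close> collapses the sums from the inside.\<close>
    let ?d = "\<lambda>i' j' k'. if k' = k then if j' = j then if i' = i then ?a else 0 else 0 else 0"
    have "cubic_form ?d = Const ?a * Var i * Var j * Var k"
      unfolding tri_def
      by (simp add: if_distrib[of Const] if_distrib[of "\<lambda>x. x * _"] sum.delta cong: if_cong)
    also have "\<dots> = Poly_Mapping.single m ?a"
      by (simp add: m Const_def Var_def mult_single add.assoc)
    finally show ?case using insert.hyps c
      by (intro exI[of _ "\<lambda>i' j' k'. ?d i' j' k' + c i' j' k'"])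
         (simp add: tri_def Const.add distrib_right sum.distrib)
  qed
  from this[of "Poly_Mapping.keys F"] obtain c where c: "F = cubic_form c"
    by (auto simp: mpoly_sum_monomials)
  define d where "d i j k = (c i j k + c i k j + c j i k + c j k i + c k i j + c k j i) / 6" for i j k
  have perm: "cubic_form (\<lambda>i j k. e j i k) = cubic_form e"
      "cubic_form (\<lambda>i j k. e i k j) = cubic_form e" for e :: "'v \<Rightarrow> 'v \<Rightarrow> 'v \<Rightarrow> 'a"
    unfolding tri_def
    by (subst sum_swap12, simp add: mult.commute mult.left_commute)
       (subst sum_swap23, simp add: mult.commute mult.left_commute)
  have six: "cubic_form (\<lambda>i j k. c i k j) = F" "cubic_form (\<lambda>i j k. c j i k) = F"
     "cubic_form (\<lambda>i j k. c j k i) = F" "cubic_form (\<lambda>i j k. c k i j) = F" "cubic_form (\<lambda>i j k. c k j i) = F"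
    using perm[of c] perm(1)[of "\<lambda>i j k. c i k j"] perm(2)[of "\<lambda>i j k. c j i k"]
      perm(1)[of "\<lambda>i j k. c k i j"] perm(2)[of "\<lambda>i j k. c j k i"] by (simp_all add: c)
  define s :: 'a where "s = 1 / 6"
  have "cubic_form d = Const s * (cubic_form c + cubic_form (\<lambda>i j k. c i k j) +
      cubic_form (\<lambda>i j k. c j i k) + cubic_form (\<lambda>i j k. c j k i) + cubic_form (\<lambda>i j k. c k i j) +
      cubic_form (\<lambda>i j k. c k j i))"
  proof -
    have "d i j k = s * (c i j k + c i k j + c j i k + c j k i + c k i j + c k j i)" for i j k
      by (simp add: d_def s_def)
    then show ?thesis
      by (simp add: tri_def Const.add Const.mult distrib_left distrib_right sum.distrib sum_distrib_left mult.assoc)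
  qed
  also have "\<dots> = Const s * (6 * F)"
    unfolding six c[symmetric] by (simp add: algebra_simps)
  also have "6 = (Const 6 :: ('v, 'a) mpoly)"
    by (simp add: Const_def)
  also have "Const s * (Const 6 * F) = Const (s * 6) * F"
    by (simp only: Const.mult mult.assoc)
  also have "\<dots> = F" by (simp add: s_def)
  finally have "F = cubic_form d" ..
  moreover have "symmetric_array d"
    by (simp add: symmetric_array_def d_def add_ac)
  ultimately show ?thesis by (rule that[rotated])
qed

section \<open>Complexification of real polynomials\<close>

lemma lookup_complexify [simp]: "Poly_Mapping.lookup (complexify p) m = complex_of_real (Poly_Mapping.lookup p m)"
  by (simp add: complexify_def map.rep_eq when_def)

lemma complexify_single: "complexify (Poly_Mapping.single m a) = Poly_Mapping.single m (complex_of_real a)"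
  by (rule poly_mapping_eqI) (simp add: lookup_single when_def)

lemma complexify_add: "complexify (p + q) = complexify p + complexify q"
  by (rule poly_mapping_eqI) (simp add: lookup_add)

lemma complexify_Const [simp]: "complexify (Const a) = Const (complex_of_real a)"
  and complexify_Var [simp]: "complexify (Var i) = Var i"
  by (simp_all add: Const_def Var_def complexify_single)

interpretation complexify: coeff_hom complexify
proof
  show "complexify (p * q) = complexify p * complexify q" for p q :: "('v, real) mpoly"
  proof (induction p rule: mpoly_induct)
    case (single m a)
    show ?case
      by (induction q rule: mpoly_induct)
         (simp_all add: complexify_single mult_single complexify_add distrib_left)
  qed (simp add: complexify_add distrib_right)
  show "complexify 1 = (1 :: ('v, complex) mpoly)"
    using complexify_Const[of 1] by (simp add: Const_def)
qed (simp_all add: complexify_add, metis Const.zero complexify_Const of_real_0)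

lemma complexify_cubic_form: "complexify (cubic_form c) = cubic_form (\<lambda>i j k. complex_of_real (c i j k))"
  by (simp add: complexify.tri)

section \<open>Partial derivatives of cubic forms\<close>

lemma pderiv_at_superset:
  assumes "finite S" "Poly_Mapping.keys p \<subseteq> S"
  shows "pderiv_at i p = (\<Sum>m\<in>S. Poly_Mapping.single (m - Poly_Mapping.single i 1)
          (of_nat (Poly_Mapping.lookup m i) * Poly_Mapping.lookup p m))"
  unfolding pderiv_at_def using assms by (intro sum.mono_neutral_left) (auto simp: in_keys_iff)

lemma pderiv_at_single: "pderiv_at i (Poly_Mapping.single m a) =
    Poly_Mapping.single (m - Poly_Mapping.single i 1) (of_nat (Poly_Mapping.lookup m i) * a)"
  using pderiv_at_superset[of "{m}" "Poly_Mapping.single m a" i] by simp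

lemma pderiv_at_add: "pderiv_at i (p + q) = pderiv_at i p + pderiv_at i q"
proof -
  let ?S = "Poly_Mapping.keys p \<union> Poly_Mapping.keys q"
  have "Poly_Mapping.keys (p + q) \<subseteq> ?S" by (rule keys_add)
  then show ?thesis
    by (simp add: pderiv_at_superset[of ?S] lookup_add distrib_left single_add sum.distrib)
qed

lemma pderiv_at_0 [simp]: "pderiv_at i 0 = 0"
  by (simp add: pderiv_at_def)

lemma pderiv_at_sum: "pderiv_at i (sum f A) = (\<Sum>j\<in>A. pderiv_at i (f j))"
  by (induction A rule: infinite_finite_induct) (auto simp: pderiv_at_add)

lemma pderiv_at_Const [simp]: "pderiv_at i (Const a) = 0"
  by (simp add: Const_def pderiv_at_single)

lemma pderiv_at_1 [simp]: "pderiv_at i 1 = 0"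
  using pderiv_at_Const[of i 1] by (simp add: Const_def)

lemma pderiv_at_Const_mult: "pderiv_at i (Const a * p) = Const a * pderiv_at i p"
  by (induction p rule: mpoly_induct)
     (simp add: Const_def pderiv_at_single mult_single mult.left_commute,
      simp add: pderiv_at_add distrib_left)

lemma pderiv_at_Var_mult:
  "pderiv_at l (Var j * p) = (if j = l then p else 0) + Var j * pderiv_at l p"
proof (induction p rule: mpoly_induct)
  case (single m a)
  let ?e = "\<lambda>j. Poly_Mapping.single j (1::nat)"
  \<comment> \<open>Subtraction of exponents is truncated, so it can be moved past
    \<open>?e j\<close> only if the variable \<open>l\<close> occurs in \<open>m\<close>.\<close>
  have *: "?e j + m - ?e l = ?e j + (m - ?e l)" if "Poly_Mapping.lookup m l \<noteq> 0"
    using that by (intro poly_mapping_eqI) (auto simp: lookup_add lookup_minus lookup_single when_def)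
  show ?case
  proof (cases "Poly_Mapping.lookup m l = 0")
    case True
    then show ?thesis
      by (auto simp: Var_def pderiv_at_single mult_single lookup_add lookup_single)
  next
    case False
    then have "j = l \<Longrightarrow> ?e j + (m - ?e l) = m"
      using * by (metis add_diff_cancel_left')
    then show ?thesis
      by (auto simp: Var_def pderiv_at_single mult_single *[OF False, unfolded One_nat_def] lookup_add
          lookup_single distrib_right single_add)
  qed
qed (simp add: pderiv_at_add distrib_left)

lemma pderiv_at_cubic_form:
  fixes c :: "'v::finite \<Rightarrow> 'v \<Rightarrow> 'v \<Rightarrow> 'a::field"
  defines "C \<equiv> \<lambda>i j k. Const (c i j k)" and "e \<equiv> \<lambda>l i. if i = l then 1 else 0"
  shows "pderiv_at l (cubic_form c) = tri C (e l) Var Var + tri C Var (e l) Var + tri C Var Var (e l)"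
proof -
  have 1: "pderiv_at l (Var k) = e l k" for k
    using pderiv_at_Var_mult[of l k 1] by (simp add: e_def)
  have 2: "pderiv_at l (Var k * p) = e l k * p + Var k * pderiv_at l p" for k and p :: "('v, 'a) mpoly"
    by (simp add: pderiv_at_Var_mult e_def)
  show ?thesis
    unfolding tri_def
    by (simp add: mult.assoc pderiv_at_sum pderiv_at_Const_mult 1 2 C_def distrib_left sum.distrib)
qed

section \<open>Singular points and linear subspaces via the polarization\<close>

definition trilin :: "('v::finite \<Rightarrow> 'v \<Rightarrow> 'v \<Rightarrow> 'a) \<Rightarrow> 'a ^ 'v \<Rightarrow> 'a ^ 'v \<Rightarrow> 'a ^ 'v \<Rightarrow> 'a::comm_ring_1"
  where "trilin c x y z = tri c (\<lambda>i. x $ i) (\<lambda>i. y $ i) (\<lambda>i. z $ i)"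

text \<open>The polarization without its coefficient array. A real cubic gives two instances, over
  the reals and over the complex numbers.\<close>

locale sym_trilinear =
  fixes T :: "'a::field_char_0 ^ 'v::finite \<Rightarrow> 'a ^ 'v \<Rightarrow> 'a ^ 'v \<Rightarrow> 'a"
  assumes add1: "T (x + x') y z = T x y z + T x' y z"
    and scale1: "T (a *s x) y z = a * T x y z"
    and swap12: "T x y z = T y x z"
    and swap23: "T x y z = T x z y"
begin

lemma add2: "T x (y + y') z = T x y z + T x y' z"
  by (metis add1 swap12)
lemma add3: "T x y (z + z') = T x y z + T x y z'"
  by (metis add2 swap23)
lemma scale2: "T x (a *s y) z = a * T x y z"
  by (metis scale1 swap12)
lemma scale3: "T x y (a *s z) = a * T x y z"
  by (metis scale2 swap23)

lemmas linear = add1 add2 add3 scale1 scale2 scale3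

lemma zero [simp]: "T 0 y z = 0" "T x 0 z = 0" "T x y 0 = 0"
  using scale1[of 0 0 y z] scale2[of x 0 0 z] scale3[of x y 0 0] by simp_all

lemma perms: "T y x z = T x y z" "T x z y = T x y z" "T y z x = T x y z" "T z x y = T x y z" "T z y x = T x y z"
  by (metis swap12 swap23)+

text \<open>Inclusion-exclusion over the subsets of the three arguments. It shows that the
  polarization vanishes on every linear subspace contained in the cubic.\<close>

lemma polarize:
  "6 * T x y z = T (x + y + z) (x + y + z) (x + y + z) - T (x + y) (x + y) (x + y)
     - T (x + z) (x + z) (x + z) - T (y + z) (y + z) (y + z) + T x x x + T y y y + T z z z"
  using perms[of x y z] swap12[of x y x] swap23[of x x y] swap12[of x z x] swap23[of x x z]
    swap12[of y z y] swap23[of y y z] swap12[of y x y] swap23[of y y x] swap12[of z x z] swap23[of z z x]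
    swap12[of z y z] swap23[of z z y]
  by (simp add: linear)

lemma polarize_subspace:
  assumes "vec.subspace W" "\<forall>x\<in>W. T x x x = 0" "x \<in> W" "y \<in> W" "z \<in> W"
  shows "T x y z = 0"
  using polarize[of x y z] assms by (simp add: vec.subspace_add)

end

lemma sym_trilinear_trilin:
  assumes "symmetric_array c"
  shows "sym_trilinear (trilin c)"
  by standard
     (auto simp: trilin_def tri_linear intro: tri_swap12[OF assms] tri_swap23[OF assms])

lemma eval_at_cubic_form: "eval_at (cubic_form c) x = trilin c x x x"
  by (simp add: eval_at_def id.eval_hom_cubic_form trilin_def)

lemma eval_at_pderiv_cubic_form:
  assumes "symmetric_array c"
  shows "eval_at (pderiv_at l (cubic_form c)) x = 3 * trilin c x x (axis l 1)"
proof -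
  have e: "eval_at (if i = l then 1 else 0) x = axis l 1 $ i" for i
    by (simp add: axis_def)
  have v: "eval_at (Var i) x = x $ i" "eval_at (Const a) x = a" for i a
    by (simp_all add: eval_at_def)
  show ?thesis
    by (simp add: pderiv_at_cubic_form eval_at.add eval_at.tri e v)
       (simp add: trilin_def tri_swap12[OF assms, of "($) (axis l 1)"] tri_swap23[OF assms, of _ "($) (axis l 1)"])
qed

lemma trilin_expand: "trilin c x y z = (\<Sum>l\<in>UNIV. z $ l * trilin c x y (axis l 1))"
proof -
  have "(\<Sum>l\<in>UNIV. z $ l * trilin c x y (axis l 1)) = trilin c x y (\<Sum>l\<in>UNIV. z $ l *s axis l 1)"
  proof -
    have "(\<Sum>l\<in>A. z $ l * trilin c x y (axis l 1)) = trilin c x y (\<Sum>l\<in>A. z $ l *s axis l 1)" for A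
      by (induction A rule: infinite_finite_induct) (simp_all add: trilin_def tri_linear, simp_all add: tri_def)
    then show ?thesis .
  qed
  then show ?thesis by (simp add: basis_expansion)
qed

text \<open>The partial derivatives at \<open>x\<close> are the values of \<open>3 * T x x\<close>
  at the coordinate vectors, so they all vanish iff this functional is zero. The equation of the
  cubic at \<open>x\<close> is then the case \<open>y = x\<close>, which is Euler's
  relation.\<close>

lemma singular_points_cubic_form:
  fixes c :: "'v::finite \<Rightarrow> 'v \<Rightarrow> 'v \<Rightarrow> 'a::field_char_0"
  assumes c: "symmetric_array c"
  shows "singular_points (cubic_form c) = {vec.span {x} | x. x \<noteq> 0 \<and> (\<forall>y. trilin c x x y = 0)}"
proof -
  interpret sym_trilinear "trilin c" by (rule sym_trilinear_trilin[OF c])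
  have sing: "(eval_at (cubic_form c) x = 0 \<and> (\<forall>i. eval_at (pderiv_at i (cubic_form c)) x = 0))
      \<longleftrightarrow> (\<forall>y. trilin c x x y = 0)" for x
  proof -
    have "trilin c x x y = 0" if "\<forall>i. trilin c x x (axis i 1) = 0" for y
      using that by (subst trilin_expand) simp
    then show ?thesis
      unfolding eval_at_cubic_form eval_at_pderiv_cubic_form[OF c] by auto
  qed
  have lines: "proj_subspaces 0 = {vec.span {x} | x :: 'a ^ 'v. x \<noteq> 0}"
  proof safe
    fix L :: "('a ^ 'v) set" assume "L \<in> proj_subspaces 0"
    then have L: "vec.subspace L" "vec.dim L = 1" by (auto simp: proj_subspaces_def)
    obtain B where B: "B \<subseteq> L" "vec.independent B" "L \<subseteq> vec.span B" "card B = 1"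
      using vec.basis_exists[of L] L(2) by metis
    then obtain x where "B = {x}" by (auto simp: card_1_singleton_iff)
    then show "\<exists>x. L = vec.span {x} \<and> x \<noteq> 0"
      using B L(1) by (metis vec.dependent_single vec.span_subspace)
  next
    fix x :: "'a ^ 'v" assume "x \<noteq> 0"
    then show "vec.span {x} \<in> proj_subspaces 0"
      by (simp add: proj_subspaces_def vec.dim_span vec.dim_eq_card_independent vec.dependent_single)
  qed
  have "(\<forall>z\<in>vec.span {x}. \<forall>y. trilin c z z y = 0) \<longleftrightarrow> (\<forall>y. trilin c x x y = 0)" for x
    by (auto simp: vec.span_singleton linear)
  then show ?thesis
    unfolding singular_points_def sing lines by blast
qed

lemma linear_subspaces_cubic_form:
  fixes c :: "'v::finite \<Rightarrow> 'v \<Rightarrow> 'v \<Rightarrow> 'a::field_char_0"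
  shows "linear_subspaces_in (cubic_form c) d =
    {W. vec.subspace W \<and> vec.dim W = d + 1 \<and> (\<forall>x\<in>W. trilin c x x x = 0)}"
  by (auto simp: linear_subspaces_in_def proj_subspaces_def eval_at_cubic_form)

section \<open>Factors of homogeneous polynomials\<close>

lemma single_eq_Const_mult_prod:
  "Poly_Mapping.single m a = Const a * (\<Prod>i\<in>UNIV. Var i ^ Poly_Mapping.lookup m i)"
  for a :: "'a::comm_ring_1" and m :: "'v::finite \<Rightarrow>\<^sub>0 nat"
proof -
  have pow: "Var i ^ n = Poly_Mapping.single (Poly_Mapping.single i n) (1::'a)" for i :: 'v and n
    by (induction n) (simp_all add: Var_def mult_single single_add[symmetric])
  have "(\<Prod>i\<in>A. Var i ^ Poly_Mapping.lookup m i)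
      = Poly_Mapping.single (\<Sum>i\<in>A. Poly_Mapping.single i (Poly_Mapping.lookup m i)) (1::'a)" for A
    by (induction A rule: infinite_finite_induct) (simp_all add: pow mult_single)
  moreover have "(\<Sum>i\<in>UNIV. Poly_Mapping.single i (Poly_Mapping.lookup m i)) = m"
    by (intro poly_mapping_eqI) (simp add: lookup_sum lookup_single when_def)
  ultimately show ?thesis by (simp add: Const_def mult_single)
qed

text \<open>The substitution of \<open>x\<^sub>i t\<close> for \<open>x\<^sub>i\<close>: the coefficient of \<open>t ^ d\<close> is the homogeneous
  component of degree \<open>d\<close>.\<close>

definition homogenize :: "('v::finite, 'a::comm_ring_1) mpoly \<Rightarrow> ('v, 'a) mpoly poly"
  where "homogenize = eval_hom (\<lambda>a. [:Const a:]) (\<lambda>i. monom (Var i) 1)"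

interpretation Const_poly: coeff_hom "\<lambda>a. [:Const a:]"
  by standard (simp_all add: Const.add Const.mult)

interpretation homogenize: coeff_hom homogenize
  unfolding homogenize_def by (rule Const_poly.coeff_hom_eval_hom)

lemma homogenize_single:
  fixes a :: "'b::comm_ring_1" and m :: "'a::finite \<Rightarrow>\<^sub>0 nat"
  shows "homogenize (Poly_Mapping.single m a)
    = monom (Poly_Mapping.single m a) (\<Sum>i\<in>UNIV. Poly_Mapping.lookup m i)"
proof -
  have "(\<Prod>i\<in>A. monom (Var i :: ('a, 'b) mpoly) 1 ^ Poly_Mapping.lookup m i)
     = monom (\<Prod>i\<in>A. Var i ^ Poly_Mapping.lookup m i) (\<Sum>i\<in>A. Poly_Mapping.lookup m i)" for A
    by (induction A rule: infinite_finite_induct) (simp_all add: monom_power mult_monom)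
  then show ?thesis
    unfolding homogenize_def Const_poly.eval_hom_single
    by (subst single_eq_Const_mult_prod) (simp add: smult_monom)
qed

lemma poly_homogenize: "poly (homogenize p) 1 = p"
  by (induction p rule: mpoly_induct) (simp_all add: homogenize_single homogenize.add poly_monom)

lemma homogeneous_coeff_homogenize: "homogeneous d (coeff (homogenize p) d)"
  by (induction p rule: mpoly_induct)
     (simp_all add: homogenize_single homogenize.add homogeneous_add homogeneous_single)

lemma homogenize_homogeneous:
  assumes "homogeneous d p"
  shows "homogenize p = monom p d"
proof -
  have "homogenize (\<Sum>m\<in>A. Poly_Mapping.single m (Poly_Mapping.lookup p m))
      = monom (\<Sum>m\<in>A. Poly_Mapping.single m (Poly_Mapping.lookup p m)) d"
    if "A \<subseteq> Poly_Mapping.keys p" for A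
    using that assms
    by (induction A rule: infinite_finite_induct)
       (auto simp: homogenize.add homogenize_single homogeneous_def add_monom)
  from this[of "Poly_Mapping.keys p"] show ?thesis by (simp add: mpoly_sum_monomials)
qed

text \<open>The factors \<open>G\<close> and \<open>H\<close> of \<open>F\<close> need not be
  homogeneous a priori. Their homogenizations multiply to \<open>F\<close> times the third power of
  the new variable, so their degrees add up to 3 and their leading coefficients, the top components
  of \<open>G\<close> and \<open>H\<close>, multiply to \<open>F\<close>. Both degrees are positive,
  so one of them is 1. The order on the variables provides the absence of zero divisors.\<close>

lemma cubic_irreducible_or_linear_factor:
  fixes F :: "('v::{finite,linorder}, 'a::field) mpoly"
  assumes "F \<noteq> 0" "homogeneous 3 F"
  obtains "irreducible F" | l H where "F = (\<Sum>i\<in>UNIV. Const (l i) * Var i) * H"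
proof (cases "irreducible F")
  case False
  \<comment> \<open>A cubic form vanishes at the origin, hence so does each of its
    multiples.\<close>
  have "\<not> F dvd 1"
  proof
    assume "F dvd 1"
    then obtain G where "1 = F * G" by (auto simp: dvd_def)
    then have "eval_at F 0 * eval_at G 0 = 1"
      by (metis eval_at.mult eval_at.one)
    moreover have "eval_at F 0 = 0"
    proof -
      have "(\<Prod>i\<in>UNIV. (0::'a) ^ Poly_Mapping.lookup m i) = 0" if "m \<in> Poly_Mapping.keys F" for m
      proof -
        have "(\<Sum>i\<in>UNIV. Poly_Mapping.lookup m i) = 3"
          using assms that by (simp add: homogeneous_def)
        then obtain i where "Poly_Mapping.lookup m i \<noteq> 0"
          by (cases "\<forall>i. Poly_Mapping.lookup m i = 0") auto
        then have "(0::'a) ^ Poly_Mapping.lookup m i = 0" by simp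
        then show ?thesis by (intro prod_zero bexI[of _ i]) auto
      qed
      then show ?thesis
        unfolding eval_at_def eval_hom_def by (intro sum.neutral ballI) (simp only: zero_index mult_zero_right)
    qed
    ultimately show False by simp
  qed
  with False assms obtain G H where GH: "F = G * H" "\<not> G dvd 1" "\<not> H dvd 1"
    by (auto simp: irreducible_def)
  have prod: "homogenize G * homogenize H = monom F 3"
    by (metis GH(1) assms(2) homogenize.mult homogenize_homogeneous)
  have nz: "homogenize G \<noteq> 0" "homogenize H \<noteq> 0"
    using prod assms(1) by auto
  have deg: "degree (homogenize G) + degree (homogenize H) = 3"
    using degree_mult_eq[OF nz] prod assms(1) by (simp add: degree_monom_eq)
  have lead: "lead_coeff (homogenize G) * lead_coeff (homogenize H) = F"
    using lead_coeff_mult[of "homogenize G" "homogenize H"] assms(1) by (simp add: prod degree_monom_eq)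
  \<comment> \<open>Degree zero of the homogenization means that \<open>P\<close> is a constant, and
    a nonzero constant is a unit.\<close>
  have nonunit: "degree (homogenize P) \<noteq> 0" if P: "\<not> P dvd 1" "homogenize P \<noteq> 0" for P :: "('v, 'a) mpoly"
  proof
    assume "degree (homogenize P) = 0"
    then obtain g where g: "homogenize P = [:g:]" by (rule degree_eq_zeroE)
    then have "P = g" using poly_homogenize[of P] by simp
    moreover have "homogeneous 0 g"
      using homogeneous_coeff_homogenize[of 0 P] g by simp
    ultimately obtain a where a: "P = Const a" by (metis homogeneous_0_imp_Const)
    with P g \<open>P = g\<close> have "a \<noteq> 0" by auto
    then have "P * Const (1 / a) = 1"
      unfolding a Const.mult[symmetric] by simp
    with P(1) show False by (auto simp: dvd_def)
  qed
  have linear: "\<exists>l. lead_coeff (homogenize P) = (\<Sum>i\<in>UNIV. Const (l i) * Var i)"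
    if "degree (homogenize P) = 1" for P :: "('v, 'a) mpoly"
    using homogeneous_coeff_homogenize[of 1 P] that by (metis homogeneous_1_imp_linear)
  from deg nonunit[OF GH(2) nz(1)] nonunit[OF GH(3) nz(2)]
  have "degree (homogenize G) = 1 \<or> degree (homogenize H) = 1" by linarith
  then show ?thesis
  proof
    assume "degree (homogenize G) = 1"
    with linear obtain l where "lead_coeff (homogenize G) = (\<Sum>i\<in>UNIV. Const (l i) * Var i)" by blast
    with lead show ?thesis by (intro that(2)[of l "lead_coeff (homogenize H)"]) simp
  next
    assume "degree (homogenize H) = 1"
    with linear obtain l where "lead_coeff (homogenize H) = (\<Sum>i\<in>UNIV. Const (l i) * Var i)" by blast
    with lead show ?thesis
      by (intro that(2)[of l "lead_coeff (homogenize G)"]) (simp add: mult.commute)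
  qed
qed (rule that(1))

section \<open>Points and planes on a complex cubic\<close>

lemma vec_span_singleton_eqI:
  fixes u v :: "'a::field ^ 'n"
  assumes "v \<in> vec.span {u}" "v \<noteq> 0"
  shows "vec.span {v} = vec.span {u}"
proof -
  obtain k where k: "v = k *s u"
    using assms(1) by (auto simp: vec.span_singleton)
  then have "k \<noteq> 0" using assms(2) by auto
  then have "u = (1 / k) *s v" by (simp add: k vector_smult_assoc)
  then have "u \<in> vec.span {v}" by (metis vec.span_base vec.span_scale singletonI)
  then show ?thesis using assms(1)
    by (intro subset_antisym vec.span_minimal vec.subspace_span) auto
qed

lemma vec_in_span_pair:
  fixes u v z :: "'a::field ^ 'n"
  assumes "z \<in> vec.span {u, v}"
  obtains a b where "z = a *s u + b *s v"
proof -
  obtain a where "z - a *s u \<in> vec.span {v}"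
    using assms by (auto simp: vec.span_insert)
  then obtain b where "z - a *s u = b *s v"
    by (auto simp: vec.span_singleton)
  then have "z = a *s u + b *s v" by (simp add: diff_eq_eq add.commute)
  then show ?thesis by (rule that)
qed

lemma vec_in_span_triple:
  fixes u v w z :: "'a::field ^ 'n"
  assumes "z \<in> vec.span {u, v, w}"
  obtains a b c where "z = a *s u + b *s v + c *s w"
proof -
  obtain a where "z - a *s u \<in> vec.span {v, w}"
    using assms by (auto simp: vec.span_insert[of u])
  then obtain b c where "z - a *s u = b *s v + c *s w"
    by (rule vec_in_span_pair)
  then have "z = a *s u + b *s v + c *s w" by (simp add: diff_eq_eq add_ac)
  then show ?thesis by (rule that)
qed

lemma vec_coeff_zero:
  fixes u :: "'a::field ^ 'n"
  assumes "r *s u + x = 0" "x \<in> vec.span S" "u \<notin> vec.span S"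
  shows "r = 0"
proof (rule ccontr)
  assume "r \<noteq> 0"
  then have "u = (1 / r) *s (r *s u)" by (simp add: vector_smult_assoc)
  also have "r *s u = - x" using assms(1) by (simp add: eq_neg_iff_add_eq_0)
  finally have "u \<in> vec.span S"
    using assms(2) by (metis vec.span_neg vec.span_scale)
  with assms(3) show False by simp
qed

text \<open>Take \<open>d + 1\<close> independent vectors of \<open>K\<close> and leave out one or
  another of them: each omitted vector lies in the span belonging to the other but not in its
  own.\<close>

lemma two_subspaces_of_subspace:
  fixes K :: "('a::field ^ 'n) set"
  assumes K: "vec.subspace K" and d: "vec.dim K > d" "d > 0"
  obtains U V where "vec.subspace U" "vec.subspace V" "vec.dim U = d" "vec.dim V = d"
    "U \<subseteq> K" "V \<subseteq> K" "U \<noteq> V"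
proof -
  obtain B where B: "B \<subseteq> K" "vec.independent B" "K \<subseteq> vec.span B" "card B = vec.dim K"
    by (rule vec.basis_exists)
  have fin: "finite B" using B d by (metis card.infinite not_less_zero)
  obtain D where D: "D \<subseteq> B" "card D = Suc d"
    using B(4) d obtain_subset_with_card_n[of "Suc d" B] by auto
  have finD: "finite D" using D fin finite_subset by blast
  then obtain x y where xy: "x \<in> D" "y \<in> D" "x \<noteq> y"
    using D d card_le_Suc0_iff_eq[OF finD] by auto
  have indD: "vec.independent D" using B D vec.independent_mono by blast
  have *: "vec.dim (vec.span (D - {z})) = d" "vec.span (D - {z}) \<subseteq> K" if "z \<in> D" for z
  proof -
    have "vec.independent (D - {z})" using indD vec.independent_mono by blast
    then show "vec.dim (vec.span (D - {z})) = d"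
      using that D finD by (simp add: vec.dim_eq_card_independent)
    show "vec.span (D - {z}) \<subseteq> K"
      using B D K by (intro vec.span_minimal) auto
  qed
  have "x \<in> vec.span (D - {y})" using xy by (intro vec.span_base) auto
  moreover have "x \<notin> vec.span (D - {x})"
    using indD xy by (auto simp: vec.dependent_def)
  ultimately show ?thesis
    using * xy by (intro that[of "vec.span (D - {x})" "vec.span (D - {y})"]) auto
qed

text \<open>Any vector outside the kernel spans the space together with it. The inequality also
  covers \<open>l = 0\<close>, where the kernel is everything.\<close>

lemma vec_dim_hyperplane:
  fixes l :: "'n::finite \<Rightarrow> 'a::field"
  defines "K \<equiv> {x :: 'a ^ 'n. (\<Sum>i\<in>UNIV. l i * x $ i) = 0}"
  shows "vec.subspace K" "CARD('n) \<le> vec.dim K + 1"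
proof -
  let ?l = "\<lambda>x :: 'a ^ 'n. \<Sum>i\<in>UNIV. l i * x $ i"
  have add: "?l (x + y) = ?l x + ?l y" for x y
    by (simp add: distrib_left sum.distrib)
  have scale: "?l (a *s x) = a * ?l x" for a x
    by (simp add: sum_distrib_left mult_ac)
  show K: "vec.subspace K"
    using add scale by (auto simp: K_def intro!: vec.subspaceI)
  show "CARD('n) \<le> vec.dim K + 1"
  proof (cases "K = UNIV")
    case True
    then show ?thesis using vec.dim_UNIV by (simp add: card_cart_basis)
  next
    case False
    then obtain n where n: "?l n \<noteq> 0" by (auto simp: K_def)
    have "x \<in> vec.span (insert n K)" for x
    proof -
      have "?l (x + (- ?l x / ?l n) *s n) = 0"
        unfolding add scale using n by simp
      then have "x - (?l x / ?l n) *s n \<in> K" by (simp add: K_def)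
      then have "x - (?l x / ?l n) *s n \<in> vec.span K" by (rule vec.span_base)
      then show ?thesis by (auto simp: vec.span_insert)
    qed
    then have "vec.span (insert n K) = UNIV" by auto
    then have "CARD('n) = vec.dim (insert n K)"
      by (metis vec.dim_span vec.dim_UNIV card_cart_basis)
    also have "\<dots> \<le> vec.dim K + 1"
      by (simp add: vec.dim_insert)
    finally show ?thesis .
  qed
qed

section \<open>Cubics with finitely many singular points\<close>

context sym_trilinear
begin

definition sing :: "'a ^ 'v \<Rightarrow> bool"
  where "sing x \<longleftrightarrow> x \<noteq> 0 \<and> (\<forall>y. T x x y = 0)"

definition singular_lines :: "('a ^ 'v) set set"
  where "singular_lines = {vec.span {x} | x. sing x}"

lemma infinite_singular_lines:
  assumes "infinite A" "\<And>t. t \<in> A \<Longrightarrow> sing (f t)"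
    and "\<And>s t k. s \<in> A \<Longrightarrow> t \<in> A \<Longrightarrow> f t = k *s f s \<Longrightarrow> t = s"
  shows "infinite singular_lines"
proof -
  have "inj_on (\<lambda>t. vec.span {f t}) A"
  proof (rule inj_onI)
    fix s t assume st: "s \<in> A" "t \<in> A" "vec.span {f s} = vec.span {f t}"
    then have "f t \<in> vec.span {f s}" by (simp add: vec.span_base)
    then show "s = t" using assms(3)[OF st(1,2)] by (auto simp: vec.span_singleton)
  qed
  moreover have "(\<lambda>t. vec.span {f t}) ` A \<subseteq> singular_lines"
    using assms(2) by (auto simp: singular_lines_def)
  ultimately show ?thesis
    using assms(1) by (meson finite_imageD finite_subset)
qed

text \<open>The last three hypotheses make every vector \<open>y + t *s x\<close> singular, and
  these vectors are pairwise non-proportional. Degenerate positions of singular points are excluded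
  by this lemma.\<close>

lemma no_singular_line:
  assumes fin: "finite singular_lines" and x: "x \<noteq> 0" and y: "y \<notin> vec.span {x}"
    and "\<And>z. T x x z = 0" "\<And>z. T x y z = 0" "\<And>z. T y y z = 0"
  shows False
proof -
  have "infinite singular_lines"
  proof (rule infinite_singular_lines)
    show "infinite (UNIV :: 'a set)" by (rule infinite_UNIV_char_0)
    have "y + t *s x \<noteq> 0" for t
    proof
      assume "y + t *s x = 0"
      then have "y = (- t) *s x" by (simp add: eq_neg_iff_add_eq_0 vec.scale_minus_left)
      with y show False by (metis vec.span_base vec.span_scale singletonI)
    qed
    then show "sing (y + t *s x)" for t
      using assms(4-6) by (simp add: sing_def linear perms)
    show "t = s" if eq: "y + t *s x = k *s (y + s *s x)" for s t k
    proof -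
      have *: "(1 - k) *s y = (k * s - t) *s x"
        using eq by (simp add: vec.scale_left_diff_distrib vec.scale_right_distrib algebra_simps)
      have "k = 1"
      proof (rule ccontr)
        assume "k \<noteq> 1"
        then have "y = (1 / (1 - k) * (1 - k)) *s y" by simp
        also have "\<dots> = (1 / (1 - k)) *s ((1 - k) *s y)" by (simp only: vector_smult_assoc)
        also have "\<dots> \<in> vec.span {x}"
          unfolding * by (intro vec.span_scale vec.span_base) simp
        finally show False using y by simp
      qed
      with * x show ?thesis by simp
    qed
  qed
  with fin show False by simp
qed

text \<open>Two singular points on a plane in general position to three others sweep out, under the
  standard quadratic Cremona transformation of that plane, a whole conic of singular points.\<close>

lemma singular_point_outside_plane:
  assumes W: "vec.subspace W" "vec.dim W = 3"
    and fin: "finite singular_lines" and card: "card singular_lines \<ge> 5"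
  shows "\<exists>p. sing p \<and> p \<notin> W"
proof (rule ccontr)
  assume "\<nexists>p. sing p \<and> p \<notin> W"
  then have inW: "x \<in> W" if "sing x" for x using that by blast
  obtain Ls where Ls: "set Ls = singular_lines" "distinct Ls"
    using finite_distinct_list[OF fin] by blast
  then have len: "length Ls \<ge> 5" using card by (metis distinct_card)
  have "\<exists>x. Ls ! i = vec.span {x} \<and> sing x" if "i < 5" for i
  proof -
    have "Ls ! i \<in> singular_lines" using that len Ls(1) nth_mem by fastforce
    then show ?thesis by (auto simp: singular_lines_def)
  qed
  then obtain x where x: "\<And>i. i < 5 \<Longrightarrow> Ls ! i = vec.span {x i}" "\<And>i. i < 5 \<Longrightarrow> sing (x i)"
    by metis
  have nz: "x i \<noteq> 0" and T0: "T (x i) (x i) y = 0" and xW: "x i \<in> W" if "i < 5" for i y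
    using x(2)[OF that] inW by (auto simp: sing_def)
  have pair: "x j \<notin> vec.span {x i}" if "i < 5" "j < 5" "i \<noteq> j" for i j
  proof
    assume "x j \<in> vec.span {x i}"
    then have "Ls ! j = Ls ! i" using that x(1) nz vec_span_singleton_eqI by metis
    with that len Ls(2) show False by (simp add: nth_eq_iff_index_eq)
  qed
  \<comment> \<open>If three of the points were collinear, only the mixed term of
    \<open>T (x k) (x k)\<close> would survive, so \<open>T (x i) (x j)\<close> would vanish and the
    whole line would be singular.\<close>
  have triple: "x k \<notin> vec.span {x i, x j}"
    if ijk: "i < 5" "j < 5" "k < 5" "i \<noteq> j" "i \<noteq> k" "j \<noteq> k" for i j k
  proof
    assume "x k \<in> vec.span {x i, x j}"
    then obtain a b where ab: "x k = a *s x i + b *s x j"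
      by (rule vec_in_span_pair)
    have "a \<noteq> 0"
      using ab pair[of j k] ijk by (auto simp: vec.span_singleton)
    moreover have "b \<noteq> 0"
      using ab pair[of i k] ijk by (auto simp: vec.span_singleton)
    moreover have "2 * a * b * T (x i) (x j) y = 0" for y
      using T0[of k y] T0[of i y] T0[of j y] ijk by (simp add: ab linear perms algebra_simps)
    ultimately have "T (x i) (x j) y = 0" for y by simp
    then show False
      using no_singular_line[OF fin nz[OF ijk(1)] pair[OF ijk(1,2,4)]] T0[OF ijk(1)] T0[OF ijk(2)] by blast
  qed
  let ?B = "{x 0, x 1, x 2}"
  have distinct: "x 0 \<noteq> x 1" "x 0 \<noteq> x 2" "x 1 \<noteq> x 2"
    using pair[of 0 1] pair[of 0 2] pair[of 1 2] by (auto simp: vec.span_base)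
  have ind: "vec.independent ?B"
    using triple[of 1 2 0] pair[of 2 1] nz[of 2]
    by (auto simp: vec.independent_insert)
  have "W \<subseteq> vec.span ?B"
    using ind W(2) distinct xW by (intro vec.card_ge_dim_independent) auto
  then have coord: "\<exists>a b c. x k = a *s x 0 + b *s x 1 + c *s x 2" if "k < 5" for k
  proof -
    have "x k \<in> vec.span ?B" using \<open>W \<subseteq> vec.span ?B\<close> xW that by blast
    then show ?thesis by (meson vec_in_span_triple)
  qed
  have nonzero: "a \<noteq> 0 \<and> b \<noteq> 0 \<and> c \<noteq> 0"
    if k: "k < 5" "k > 2" and e: "x k = a *s x 0 + b *s x 1 + c *s x 2" for k a b c
  proof -
    have mem: "r *s u + s *s v \<in> vec.span {u, v}" for r s and u v :: "'a ^ 'v"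
      by (intro vec.span_add vec.span_scale vec.span_base) auto
    show ?thesis
      using mem[of b "x 1" c "x 2"] mem[of a "x 0" c "x 2"] mem[of a "x 0" b "x 1"]
        triple[of 1 2 k] triple[of 0 2 k] triple[of 0 1 k] k by (auto simp: e)
  qed
  define f where "f i j y = T (x i) (x j) y" for i j y
  \<comment> \<open>Only the mixed terms of \<open>T (x k) (x k) y = 0\<close> remain. Division by
    \<open>a * b * c\<close> makes the relation linear in the reciprocal coordinates, so the
    relations of \<open>x 3\<close> and \<open>x 4\<close> can be combined linearly.\<close>
  have rel: "(1 / c) * f 0 1 y + (1 / b) * f 0 2 y + (1 / a) * f 1 2 y = 0"
    if k: "k < 5" "k > 2" and e: "x k = a *s x 0 + b *s x 1 + c *s x 2" for k a b c y
  proof -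
    have nz': "a \<noteq> 0" "b \<noteq> 0" "c \<noteq> 0" using nonzero[OF k e] by auto
    have "2 * (a * b * f 0 1 y + a * c * f 0 2 y + b * c * f 1 2 y) = 0"
      using T0[of k y] T0[of 0 y] T0[of 1 y] T0[of 2 y] k
      by (simp add: e linear f_def perms algebra_simps)
    moreover have "v = 0" if "2 * v = 0" for v :: 'a using that by simp
    ultimately have "a * b * f 0 1 y + a * c * f 0 2 y + b * c * f 1 2 y = 0" by blast
    moreover have "(1 / c) * f 0 1 y + (1 / b) * f 0 2 y + (1 / a) * f 1 2 y
        = (a * b * f 0 1 y + a * c * f 0 2 y + b * c * f 1 2 y) / (a * b * c)"
      using nz' by (simp add: add_divide_distrib)
    ultimately show ?thesis by simp
  qed
  obtain a0 a1 a2 where a: "x 3 = a0 *s x 0 + a1 *s x 1 + a2 *s x 2" using coord[of 3] by auto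
  obtain b0 b1 b2 where b: "x 4 = b0 *s x 0 + b1 *s x 1 + b2 *s x 2" using coord[of 4] by auto
  have anz: "a0 \<noteq> 0" "a1 \<noteq> 0" "a2 \<noteq> 0" using nonzero[OF _ _ a] by auto
  have bnz: "b0 \<noteq> 0" "b1 \<noteq> 0" "b2 \<noteq> 0" using nonzero[OF _ _ b] by auto
  \<comment> \<open>The \<open>u\<close>'s run along the line joining the reciprocal coordinate
    vectors of \<open>x 3\<close> and \<open>x 4\<close>. Then \<open>z\<close> takes reciprocals
    once more, cleared of denominators, and traces a conic.\<close>
  define u0 where "u0 t = t * (1 / a0) + 1 / b0" for t
  define u1 where "u1 t = t * (1 / a1) + 1 / b1" for t
  define u2 where "u2 t = t * (1 / a2) + 1 / b2" for t
  define z where "z t = (u1 t * u2 t) *s x 0 + (u0 t * u2 t) *s x 1 + (u0 t * u1 t) *s x 2" for t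
  have lin: "r = r' \<and> s = s' \<and> t = t'"
    if "r *s x 0 + s *s x 1 + t *s x 2 = r' *s x 0 + s' *s x 1 + t' *s x 2" for r s t r' s' t'
  proof -
    have eq: "(r - r') *s x 0 + ((s - s') *s x 1 + (t - t') *s x 2) = 0"
      using that by (simp add: vec_eq_iff algebra_simps)
    have mem: "a *s u + b *s v \<in> vec.span {u, v}" for a b and u v :: "'a ^ 'v"
      by (intro vec.span_add vec.span_scale vec.span_base) auto
    have "r - r' = 0"
      using eq mem by (rule vec_coeff_zero) (rule triple, auto)
    moreover have "s - s' = 0"
    proof (rule vec_coeff_zero)
      show "(s - s') *s x 1 + ((r - r') *s x 0 + (t - t') *s x 2) = 0"
        using eq by (simp only: add.left_commute)
    qed (rule mem, rule triple, auto)
    moreover have "t - t' = 0"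
    proof (rule vec_coeff_zero)
      show "(t - t') *s x 2 + ((r - r') *s x 0 + (s - s') *s x 1) = 0"
        using eq by (simp only: add_ac)
    qed (rule mem, rule triple, auto)
    ultimately show ?thesis by simp
  qed
  \<comment> \<open>The removed parameters are those at which one of the \<open>u\<close>'s
    vanishes.\<close>
  let ?A = "- {- (1 / b0) * a0, - (1 / b1) * a1, - (1 / b2) * a2}"
  have unz: "u0 t \<noteq> 0" "u1 t \<noteq> 0" "u2 t \<noteq> 0" if "t \<in> ?A" for t
  proof -
    have "t = - (1 / b) * a" if "t * (1 / a) + 1 / b = 0" "a \<noteq> 0" for a b
    proof -
      have "t = (t * (1 / a)) * a" using that by simp
      also have "t * (1 / a) = - (1 / b)" using that by (simp only: eq_neg_iff_add_eq_0)
      finally show ?thesis .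
    qed
    then show "u0 t \<noteq> 0" "u1 t \<noteq> 0" "u2 t \<noteq> 0"
      using that anz unfolding u0_def u1_def u2_def by blast+
  qed
  have "infinite singular_lines"
  proof (rule infinite_singular_lines)
    show "infinite ?A"
      using infinite_UNIV_char_0[where 'a='a] by (simp add: finite_compl)
    show "sing (z t)" if t: "t \<in> ?A" for t
    proof -
      have "z t \<noteq> 0"
        using lin[of "u1 t * u2 t" "u0 t * u2 t" "u0 t * u1 t" 0 0 0] unz[OF t] by (auto simp: z_def)
      moreover have "T (z t) (z t) y = 0" for y
      proof -
        \<comment> \<open>Each product of two different coordinates of \<open>z t\<close> is
          \<open>u0 t * u1 t * u2 t\<close> times one of the \<open>u\<close>'s. What remains is
          linear in the \<open>u\<close>'s, hence a combination of the two relations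
          \<open>rel\<close>.\<close>
        have "T (z t) (z t) y = 2 * u0 t * u1 t * u2 t * (u2 t * f 0 1 y + u1 t * f 0 2 y + u0 t * f 1 2 y)"
          using T0[of 0 y] T0[of 1 y] T0[of 2 y]
          by (simp add: z_def linear f_def perms algebra_simps)
        also have "u2 t * f 0 1 y + u1 t * f 0 2 y + u0 t * f 1 2 y
            = t * ((1 / a2) * f 0 1 y + (1 / a1) * f 0 2 y + (1 / a0) * f 1 2 y)
              + ((1 / b2) * f 0 1 y + (1 / b1) * f 0 2 y + (1 / b0) * f 1 2 y)"
          unfolding u0_def u1_def u2_def by (simp only: distrib_left distrib_right mult.assoc add_ac)
        also have "\<dots> = 0"
        proof -
          have "(1 / a2) * f 0 1 y + (1 / a1) * f 0 2 y + (1 / a0) * f 1 2 y = 0"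
            by (rule rel[OF _ _ a]) simp_all
          moreover have "(1 / b2) * f 0 1 y + (1 / b1) * f 0 2 y + (1 / b0) * f 1 2 y = 0"
            by (rule rel[OF _ _ b]) simp_all
          ultimately show ?thesis by (simp only: mult_zero_right add_0)
        qed
        finally show ?thesis by simp
      qed
      ultimately show ?thesis by (simp add: sing_def)
    qed
    show "t = s" if st: "s \<in> ?A" "t \<in> ?A" and eq: "z t = k *s z s" for s t k
    proof (rule ccontr)
      assume "t \<noteq> s"
      from eq have "z t = (k * (u1 s * u2 s)) *s x 0 + (k * (u0 s * u2 s)) *s x 1 + (k * (u0 s * u1 s)) *s x 2"
        by (simp add: z_def vec.scale_right_distrib vector_smult_assoc)
      then have k: "u1 t * u2 t = k * (u1 s * u2 s)" "u0 t * u2 t = k * (u0 s * u2 s)"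
          "u0 t * u1 t = k * (u0 s * u1 s)"
        using lin unfolding z_def by blast+
      have "k \<noteq> 0" using k(1) unz[OF st(2)] by auto
      have "u2 t * (u0 t * u1 s) * (k * u2 s) = u2 t * (u1 t * u0 s) * (k * u2 s)"
        using k(1,2) by algebra
      then have e1: "u0 t * u1 s = u1 t * u0 s" using unz[OF st(1)] unz[OF st(2)] \<open>k \<noteq> 0\<close> by simp
      have "u1 t * (u0 t * u2 s) * (k * u1 s) = u1 t * (u2 t * u0 s) * (k * u1 s)"
        using k(1,3) by algebra
      then have e2: "u0 t * u2 s = u2 t * u0 s" using unz[OF st(1)] unz[OF st(2)] \<open>k \<noteq> 0\<close> by simp
      \<comment> \<open>Proportional \<open>z s\<close> and \<open>z t\<close> have proportional
        \<open>u\<close>'s, so their two-by-two minors vanish. Such a minor is \<open>t - s\<close>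
        times a minor of the reciprocal coordinates of \<open>x 3\<close> and \<open>x 4\<close>;
        for \<open>t\<close> different from \<open>s\<close> these two points would
        coincide.\<close>
      have minor: "(t * al + be) * (s * al' + be') - (t * al' + be') * (s * al + be)
          = (t - s) * (al * be' - al' * be)" for al be al' be'
        by (simp add: algebra_simps)
      have "(t - s) * ((1 / a0) * (1 / b1) - (1 / a1) * (1 / b0)) = u0 t * u1 s - u1 t * u0 s"
        unfolding u0_def u1_def by (simp only: minor)
      with e1 \<open>t \<noteq> s\<close> have "(1 / a0) * (1 / b1) = (1 / a1) * (1 / b0)" by simp
      then have r1: "b1 = b0 / a0 * a1" using anz bnz by (simp add: field_simps)
      have "(t - s) * ((1 / a0) * (1 / b2) - (1 / a2) * (1 / b0)) = u0 t * u2 s - u2 t * u0 s"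
        unfolding u0_def u2_def by (simp only: minor)
      with e2 \<open>t \<noteq> s\<close> have "(1 / a0) * (1 / b2) = (1 / a2) * (1 / b0)" by simp
      then have r2: "b2 = b0 / a0 * a2" using anz bnz by (simp add: field_simps)
      have "x 4 = (b0 / a0) *s x 3"
        using anz by (simp add: a b r1 r2 vec.scale_right_distrib vector_smult_assoc)
      then show False using pair[of 3 4] by (auto simp: vec.span_singleton)
    qed
  qed
  with fin show False by simp
qed

end

text \<open>Completing the square, with \<open>t = A\<close> to avoid a division. The zero supplies
  the remaining direction of the second plane.\<close>

lemma complex_binary_quadratic_root:
  obtains s t :: complex where "s \<noteq> 0 \<or> t \<noteq> 0" "A * s\<^sup>2 + 2 * B * s * t + C * t\<^sup>2 = 0"
proof (cases "A = 0")
  case True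
  then show ?thesis by (intro that[of 1 0]) auto
next
  case False
  define s where "s = csqrt (B\<^sup>2 - A * C) - B"
  have "A * s\<^sup>2 + 2 * B * s * A + C * A\<^sup>2 = A * ((s + B)\<^sup>2 - (B\<^sup>2 - A * C))"
    by (simp add: power2_eq_square algebra_simps)
  also have "(s + B)\<^sup>2 = B\<^sup>2 - A * C" by (simp add: s_def)
  finally show ?thesis using False by (intro that[of s A]) auto
qed

text \<open>If the line joining two singular points off the plane \<open>W\<close> meets \<open>W\<close>, then the residual quadric
  in the span of \<open>W\<close> and that line is singular along the line, hence splits into planes.\<close>

lemma second_plane:
  fixes T :: "complex ^ 'v::finite \<Rightarrow> complex ^ 'v \<Rightarrow> complex ^ 'v \<Rightarrow> complex"
  assumes T: "sym_trilinear T"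
    and W: "vec.subspace W" "vec.dim W = 3" "\<forall>x\<in>W. T x x x = 0"
    and p: "sym_trilinear.sing T p" "p \<notin> W" and q: "sym_trilinear.sing T q" "q \<notin> W"
    and pq: "q \<in> vec.span (insert p W)" "q \<notin> vec.span {p}"
  obtains V where "vec.subspace V" "vec.dim V = 3" "\<forall>x\<in>V. T x x x = 0" "V \<noteq> W"
proof -
  interpret sym_trilinear T by (rule T)
  have TW: "T x y z = 0" if "x \<in> W" "y \<in> W" "z \<in> W" for x y z
    using polarize_subspace[OF W(1,3) that] .
  have Tp: "T p p y = 0" and Tq: "T q q y = 0" for y
    using p q by (auto simp: sing_def)
  have spanW: "vec.span W = W" using W(1) by (simp add: vec.span_eq_iff)
  obtain k where "q - k *s p \<in> W"
    using pq(1) spanW by (auto simp: vec.span_insert)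
  \<comment> \<open>The point where the line through \<open>p\<close> and \<open>q\<close> meets the
    plane \<open>W\<close>.\<close>
  define r where "r = q - k *s p"
  have r: "r \<in> W" and qr: "q = k *s p + r"
    using \<open>q - k *s p \<in> W\<close> by (simp_all add: r_def)
  have "k \<noteq> 0" using q(2) r qr by auto
  have "r \<noteq> 0" using pq(2) qr by (auto simp: vec.span_singleton)
  \<comment> \<open>In the expansion of \<open>T q q x\<close> with \<open>q = k *s p + r\<close>
    the pure terms vanish, since \<open>p\<close> is singular and \<open>W\<close> lies in the
    cubic.\<close>
  have Tpr: "T p r x = 0" if "x \<in> W" for x
  proof -
    have "T q q x = 2 * k * T p r x"
      using Tp[of x] TW[OF r r that] by (simp add: qr linear perms)
    with Tq \<open>k \<noteq> 0\<close> show ?thesis by simp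
  qed
  obtain B where B: "{r} \<subseteq> B" "B \<subseteq> W" "vec.independent B" "W \<subseteq> vec.span B"
    using vec.maximal_independent_subset_extend[of "{r}" W] r \<open>r \<noteq> 0\<close>
    by (auto simp: vec.dependent_single)
  have "card B = 3"
    using B W(2) vec.basis_card_eq_dim[of B W] by simp
  then obtain e f where ef: "B = {r, e, f}" "r \<noteq> e" "r \<noteq> f" "e \<noteq> f"
    using B(1) by (auto simp: card_3_iff)
  \<comment> \<open>By \<open>Tpr\<close> the quadratic form \<open>T p x x\<close> on
    \<open>W\<close> has \<open>r\<close> in its radical, so it is determined by its restriction to
    the span of \<open>e\<close> and \<open>f\<close>. A zero \<open>w\<close> there makes it vanish
    on the span of \<open>w\<close> and \<open>r\<close>, and adding \<open>p\<close> gives the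
    second plane.\<close>
  obtain s t where st: "s \<noteq> 0 \<or> t \<noteq> 0"
    "T p e e * s\<^sup>2 + 2 * T p e f * s * t + T p f f * t\<^sup>2 = 0"
    by (rule complex_binary_quadratic_root)
  define w where "w = s *s e + t *s f"
  have efW: "e \<in> W" "f \<in> W" using B ef by auto
  then have w: "w \<in> W" using W(1) by (simp add: w_def vec.subspace_add vec.subspace_scale)
  have Tpww: "T p w w = 0"
    using st(2) by (simp add: w_def linear perms power2_eq_square algebra_simps)
  have indef: "e \<notin> vec.span {r, f}" "f \<notin> vec.span {r, e}"
    using B(3) ef by (auto simp: vec.dependent_def insert_Diff_if doubleton_eq_iff insert_commute)
  have wr: "w \<notin> vec.span {r}"
  proof
    assume "w \<in> vec.span {r}"
    then obtain a where "w = a *s r" by (auto simp: vec.span_singleton)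
    then have 1: "s *s e + (t *s f + (- a) *s r) = 0" and 2: "t *s f + (s *s e + (- a) *s r) = 0"
      by (simp_all add: w_def vec_eq_iff algebra_simps)
    have "s = 0"
      using 1 _ indef(1) by (rule vec_coeff_zero) (intro vec.span_add vec.span_scale vec.span_base, auto)
    moreover have "t = 0"
      using 2 _ indef(2) by (rule vec_coeff_zero) (intro vec.span_add vec.span_scale vec.span_base, auto)
    ultimately show False using st(1) by simp
  qed
  have prw: "p \<notin> vec.span {w, r}"
    using p(2) r w W(1) vec.span_minimal[of "{w, r}" W] by auto
  have ind: "vec.independent {p, w, r}"
    using prw wr \<open>r \<noteq> 0\<close> by (auto simp: vec.independent_insert)
  have distinct: "p \<noteq> w" "p \<noteq> r" "w \<noteq> r"
    using prw wr by (auto intro: vec.span_base)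
  show ?thesis
  proof (rule that)
    show "vec.subspace (vec.span {p, w, r})" by simp
    show "vec.dim (vec.span {p, w, r}) = 3"
      using distinct by (simp add: vec.dim_eq_card_independent[OF ind])
    show "\<forall>x\<in>vec.span {p, w, r}. T x x x = 0"
    proof
      fix x assume "x \<in> vec.span {p, w, r}"
      then obtain a b d where x: "x = a *s p + b *s w + d *s r" by (rule vec_in_span_triple)
      show "T x x x = 0"
        using Tp[of p] Tp[of w] Tp[of r] Tpww Tpr[OF r] Tpr[OF w] TW[OF w w w] TW[OF w w r] TW[OF w r r] TW[OF r r r]
        by (simp add: x linear perms)
    qed
    show "vec.span {p, w, r} \<noteq> W" using p(2) by (auto intro: vec.span_base)
  qed
qed

section \<open>Real structure\<close>

definition cvec :: "real ^ 'v \<Rightarrow> complex ^ 'v::finite"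
  where "cvec x = (\<chi> i. complex_of_real (x $ i))"

definition cnjv :: "complex ^ 'v \<Rightarrow> complex ^ 'v::finite"
  where "cnjv x = (\<chi> i. cnj (x $ i))"

definition Rev :: "complex ^ 'v \<Rightarrow> real ^ 'v::finite" where "Rev x = (\<chi> i. Re (x $ i))"
definition Imv :: "complex ^ 'v \<Rightarrow> real ^ 'v::finite" where "Imv x = (\<chi> i. Im (x $ i))"

lemma cvec_Re_Im: "x = cvec (Rev x) + \<i> *s cvec (Imv x)"
  by (simp add: vec_eq_iff cvec_def Rev_def Imv_def complex_eq)

lemma cvec_Rev: "cvec (Rev x) = (1 / 2) *s (x + cnjv x)"
  and cvec_Imv: "cvec (Imv x) = (- \<i> / 2) *s (x + (- 1) *s cnjv x)"
  by (auto simp: vec_eq_iff cvec_def Rev_def Imv_def cnjv_def complex_eq_iff)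

lemma cvec_linear: "cvec (x + y) = cvec x + cvec y" "cvec (a *s x) = complex_of_real a *s cvec x"
  by (simp_all add: vec_eq_iff cvec_def)

lemma cvec_eq_0_iff [simp]: "cvec x = 0 \<longleftrightarrow> x = 0"
  by (simp add: vec_eq_iff cvec_def)

lemma cnjv_linear: "cnjv (x + y) = cnjv x + cnjv y" "cnjv (a *s x) = cnj a *s cnjv x"
  by (simp_all add: vec_eq_iff cnjv_def)

lemma cnjv_cnjv [simp]: "cnjv (cnjv x) = x"
  by (simp add: vec_eq_iff cnjv_def)

lemma subspace_cnjv:
  assumes "vec.subspace U"
  shows "vec.subspace (cnjv ` U)"
proof (rule vec.subspaceI)
  show "0 \<in> cnjv ` U"
    using vec.subspace_0[OF assms] by (intro image_eqI[of _ _ 0]) (auto simp: vec_eq_iff cnjv_def)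
  show "x + y \<in> cnjv ` U" if "x \<in> cnjv ` U" "y \<in> cnjv ` U" for x y
    using that vec.subspace_add[OF assms] by (auto simp: cnjv_linear(1)[symmetric])
  show "a *s x \<in> cnjv ` U" if "x \<in> cnjv ` U" for a x
  proof -
    from that obtain u where u: "u \<in> U" "x = cnjv u" by auto
    then have "a *s x = cnjv (cnj a *s u)" by (simp add: cnjv_linear)
    then show ?thesis using u vec.subspace_scale[OF assms] by auto
  qed
qed

text \<open>Conjugation is only semilinear, but it carries spanning sets to spanning sets. The
  resulting bound, applied to \<open>U\<close> and to its conjugate, gives equality.\<close>

lemma dim_cnjv:
  assumes U: "vec.subspace U"
  shows "vec.dim (cnjv ` U) = vec.dim U"
proof -
  have le: "vec.dim (cnjv ` V) \<le> vec.dim V" for V :: "(complex ^ 'a) set"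
  proof -
    obtain B where B: "B \<subseteq> V" "vec.independent B" "V \<subseteq> vec.span B" "card B = vec.dim V"
      by (rule vec.basis_exists)
    have fin: "finite B" using B(2) by (rule vec.finiteI_independent)
    have "vec.span B \<subseteq> cnjv ` vec.span (cnjv ` B)"
      by (rule vec.span_minimal) (force intro: vec.span_base image_eqI[of _ _ "cnjv _"], simp add: subspace_cnjv)
    then have "cnjv ` V \<subseteq> vec.span (cnjv ` B)"
      using B(3) by (force simp: image_iff)
    then have "vec.dim (cnjv ` V) \<le> card (cnjv ` B)"
      using fin by (intro vec.dim_le_card) auto
    also have "\<dots> \<le> card B" using fin by (rule card_image_le)
    finally show ?thesis using B by simp
  qed
  have "cnjv ` cnjv ` U = U" by (force simp: image_iff)
  then show ?thesis using le[of U] le[of "cnjv ` U"] by simp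
qed

interpretation cnj: coeff_hom cnj
  by standard auto

lemma trilin_cvec:
  "trilin (\<lambda>i j k. complex_of_real (c i j k)) (cvec x) (cvec y) (cvec z)
    = complex_of_real (trilin c x y z)"
  by (simp add: trilin_def of_real.tri cvec_def)

lemma trilin_cnjv:
  "trilin (\<lambda>i j k. complex_of_real (c i j k)) (cnjv x) (cnjv y) (cnjv z)
    = cnj (trilin (\<lambda>i j k. complex_of_real (c i j k)) x y z)"
  by (simp add: trilin_def cnj.tri cnjv_def)

section \<open>Bases and coordinate functionals\<close>

lemma exhaust_5: "x = 0 \<or> x = 1 \<or> x = 2 \<or> x = 3 \<or> x = 4" for x :: 5
proof (induct x)
  case (of_int z)
  then have "z = 0 \<or> z = 1 \<or> z = 2 \<or> z = 3 \<or> z = 4" by simp linarith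
  then show ?case by auto
qed

lemma UNIV_5: "(UNIV :: 5 set) = {0, 1, 2, 3, 4}"
  using exhaust_5 by auto

lemma sum_5: "sum f (UNIV :: 5 set) = f 0 + f 1 + f 2 + f 3 + f 4"
  unfolding UNIV_5 by (simp add: ac_simps)

definition lin_indep :: "('n::finite \<Rightarrow> 'a::field ^ 'n) \<Rightarrow> bool"
  where "lin_indep b \<longleftrightarrow> (\<forall>a. (\<Sum>k\<in>UNIV. a k *s b k) = 0 \<longrightarrow> (\<forall>i. a i = 0))"

text \<open>\<open>d\<close> is the inverse of the matrix with columns \<open>b k\<close>. The first
  identity says that its rows read off coordinates, the second that these coordinates reconstruct a
  vector.\<close>

lemma dual_basis:
  fixes b :: "'n::finite \<Rightarrow> 'a::field ^ 'n"
  assumes "lin_indep b"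
  obtains d :: "'n \<Rightarrow> 'n \<Rightarrow> 'a"
  where "\<forall>i k. (\<Sum>j\<in>UNIV. d i j * b k $ j) = (if i = k then 1 else 0)"
    and "\<forall>i j. (\<Sum>k\<in>UNIV. b k $ i * d k j) = (if i = j then 1 else 0)"
proof -
  define M :: "'a ^ 'n ^ 'n" where "M = (\<chi> i k. b k $ i)"
  have M: "M *v x = (\<Sum>k\<in>UNIV. x $ k *s b k)" for x
    unfolding vec_eq_iff by (simp add: M_def matrix_vector_mult_def mult.commute)
  have "x = 0" if "M *v x = 0" for x
  proof -
    have "(\<Sum>k\<in>UNIV. x $ k *s b k) = 0" using that unfolding M .
    then have "\<forall>i. x $ i = 0"
      using assms unfolding lin_indep_def by (elim allE[of _ "\<lambda>k. x $ k"] mp)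
    then show ?thesis unfolding vec_eq_iff by simp
  qed
  then have "\<forall>x. M *v x = 0 \<longrightarrow> x = 0" by blast
  then have "\<exists>D. D ** M = mat 1"
    unfolding matrix_left_invertible_ker .
  then obtain D where D: "D ** M = mat 1" ..
  then have D': "M ** D = mat 1"
    by (rule matrix_left_right_inverse[THEN iffD1])
  show ?thesis
  proof (rule that[of "\<lambda>i j. D $ i $ j"])
    have "(\<Sum>j\<in>UNIV. D $ i $ j * b k $ j) = (D ** M) $ i $ k" for i k
      by (simp add: matrix_matrix_mult_def M_def)
    then show "\<forall>i k. (\<Sum>j\<in>UNIV. D $ i $ j * b k $ j) = (if i = k then 1 else 0)"
      unfolding D by (simp add: mat_def)
    have "(\<Sum>k\<in>UNIV. b k $ i * D $ k $ j) = (M ** D) $ i $ j" for i j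
      by (simp add: matrix_matrix_mult_def M_def)
    then show "\<forall>i j. (\<Sum>k\<in>UNIV. b k $ i * D $ k $ j) = (if i = j then 1 else 0)"
      unfolding D' by (simp add: mat_def)
  qed
qed

lemma basis_expand:
  fixes b :: "'n::finite \<Rightarrow> 'a::field ^ 'n"
  assumes "lin_indep b"
  obtains a where "z = (\<Sum>k\<in>UNIV. a k *s b k)"
proof -
  obtain d where d: "\<forall>i k. (\<Sum>j\<in>UNIV. d i j * b k $ j) = (if i = k then 1 else 0)"
      "\<forall>i j. (\<Sum>k\<in>UNIV. b k $ i * d k j) = (if i = j then 1 else 0)"
    by (rule dual_basis[OF assms])
  have "(\<Sum>k\<in>UNIV. (\<Sum>j\<in>UNIV. d k j * z $ j) * b k $ i) = z $ i" for i
  proof -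
    have "(\<Sum>k\<in>UNIV. (\<Sum>j\<in>UNIV. d k j * z $ j) * b k $ i)
        = (\<Sum>j\<in>UNIV. (\<Sum>k\<in>UNIV. b k $ i * d k j) * z $ j)"
      unfolding sum_distrib_right by (subst sum.swap) (simp add: mult_ac)
    also have "\<dots> = z $ i" unfolding d(2)[rule_format] by (simp add: if_distrib[of "\<lambda>x. x * _"] cong: if_cong)
    finally show ?thesis .
  qed
  then have "z = (\<Sum>k\<in>UNIV. (\<Sum>j\<in>UNIV. d k j * z $ j) *s b k)"
    by (simp add: vec_eq_iff)
  then show ?thesis by (rule that)
qed

section \<open>Real cubics, their complexification, and a normal form\<close>

locale real_cubic =
  fixes c :: "5 \<Rightarrow> 5 \<Rightarrow> 5 \<Rightarrow> real"
  assumes c: "symmetric_array c"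
begin

abbreviation "tc \<equiv> trilin c"
abbreviation "TC \<equiv> trilin (\<lambda>i j k. complex_of_real (c i j k))"

lemma C: "symmetric_array (\<lambda>i j k. complex_of_real (c i j k))"
  using c by (simp add: symmetric_array_def)

sublocale re: sym_trilinear tc by (rule sym_trilinear_trilin[OF c])
sublocale cx: sym_trilinear TC by (rule sym_trilinear_trilin[OF C])

lemma TC_cvec_eq_0:
  assumes "\<And>z. tc x y z = 0"
  shows "TC (cvec x) (cvec y) z = 0"
  by (subst cvec_Re_Im[of z]) (simp add: cx.linear trilin_cvec assms)

lemma TC_cvec_eq_0':
  assumes "\<And>y z. tc x y z = 0"
  shows "TC (cvec x) y z = 0"
  by (subst cvec_Re_Im[of y]) (simp add: cx.linear TC_cvec_eq_0 assms)

lemma sing_cnjv: "cx.sing p \<Longrightarrow> cx.sing (cnjv p)"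
proof -
  assume p: "cx.sing p"
  have "TC (cnjv p) (cnjv p) y = 0" for y
    using p trilin_cnjv[of c p p "cnjv y"] by (simp add: cx.sing_def)
  moreover have "cnjv p \<noteq> 0"
  proof
    assume "cnjv p = 0"
    then have "cnjv (cnjv p) = 0 *s cnjv 0" using cnjv_linear(2)[of 0 0] by simp
    with p show False by (simp add: cx.sing_def)
  qed
  ultimately show ?thesis by (simp add: cx.sing_def)
qed

lemma sing_cvec_imp: 
  assumes "cx.sing (cvec v)"
  shows "tc v v y = 0"
  using assms trilin_cvec[of c v v y] by (simp add: cx.sing_def)

text \<open>Otherwise polarization gives \<open>tc v y z = 0\<close> for all \<open>y\<close> and
  \<open>z\<close>, so the cubic is a cone with vertex \<open>v\<close>, and the line joining
  \<open>v\<close> to a second singular point is singular.\<close>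

lemma not_cone:
  assumes fin: "finite cx.singular_lines" "card cx.singular_lines \<ge> 2" and v: "cx.sing (cvec v)"
  obtains w where "tc v w w \<noteq> 0"
proof (cases "\<forall>w. tc v w w = 0")
  case True
  have "tc v y z = 0" for y z
  proof -
    have "tc v (y + z) (y + z) = tc v y y + 2 * tc v y z + tc v z z"
      by (simp add: re.linear re.swap23[of v z y])
    with True show ?thesis by simp
  qed
  then have cone: "TC (cvec v) y z = 0" for y z by (rule TC_cvec_eq_0')
  have "\<not> cx.singular_lines \<subseteq> {vec.span {cvec v}}"
    using fin card_mono[of "{vec.span {cvec v}}" cx.singular_lines] by auto
  then obtain q where q: "cx.sing q" "vec.span {q} \<noteq> vec.span {cvec v}"
    by (auto simp: cx.singular_lines_def)
  then have "q \<notin> vec.span {cvec v}"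
    using vec_span_singleton_eqI by (auto simp: cx.sing_def)
  then have False
    using cx.no_singular_line[OF fin(1), of "cvec v" q] cone v q(1) by (auto simp: cx.sing_def)
  then show ?thesis ..
qed (use that in blast)

text \<open>By uniqueness \<open>W\<close> equals its conjugate, so it contains the real and
  imaginary parts of its vectors. Its real vectors therefore span it, and a basis can be chosen
  among them.\<close>

lemma real_plane_basis:
  assumes uniq: "\<exists>!W. vec.subspace W \<and> vec.dim W = 3 \<and> (\<forall>x\<in>W. TC x x x = 0)"
    and W: "vec.subspace W" "vec.dim W = 3" "\<forall>x\<in>W. TC x x x = 0"
  shows "\<And>x. x \<in> W \<Longrightarrow> cnjv x \<in> W"
    and "\<exists>w0 w1 w2. w0 \<noteq> w1 \<and> w0 \<noteq> w2 \<and> w1 \<noteq> w2 \<and> {cvec w0, cvec w1, cvec w2} \<subseteq> W \<and>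
      vec.independent {cvec w0, cvec w1, cvec w2}"
proof -
  have "\<forall>x\<in>cnjv ` W. TC x x x = 0"
    using W(3) by (simp add: trilin_cnjv)
  moreover have "vec.subspace (cnjv ` W)" "vec.dim (cnjv ` W) = 3"
    using W by (simp_all add: subspace_cnjv dim_cnjv)
  ultimately have "cnjv ` W = W" using uniq W by blast
  then show cnj: "cnjv x \<in> W" if "x \<in> W" for x using that by blast
  let ?R = "W \<inter> range cvec"
  have "W \<subseteq> vec.span ?R"
  proof
    fix x assume x: "x \<in> W"
    have "cvec (Rev x) \<in> W" "cvec (Imv x) \<in> W"
      unfolding cvec_Rev cvec_Imv
      by (intro vec.subspace_scale vec.subspace_add W(1) x cnj)+
    then show "x \<in> vec.span ?R"
      by (subst cvec_Re_Im) (intro vec.span_add vec.span_scale vec.span_base, auto)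
  qed
  then have dim: "vec.dim ?R = 3"
    using W by (metis vec.dim_span vec.span_minimal inf_le1 subset_antisym)
  obtain B where B: "B \<subseteq> ?R" "vec.independent B" "card B = 3"
    using vec.basis_exists[of ?R] dim by metis
  then obtain x y z where "B = {x, y, z}" "x \<noteq> y" "x \<noteq> z" "y \<noteq> z" by (auto simp: card_3_iff)
  moreover obtain w0 w1 w2 where "x = cvec w0" "y = cvec w1" "z = cvec w2"
    using B(1) calculation(1) by auto
  ultimately show "\<exists>w0 w1 w2. w0 \<noteq> w1 \<and> w0 \<noteq> w2 \<and> w1 \<noteq> w2 \<and> {cvec w0, cvec w1, cvec w2} \<subseteq> W \<and>
      vec.independent {cvec w0, cvec w1, cvec w2}"
    using B by (intro exI[of _ w0] exI[of _ w1] exI[of _ w2]) auto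
qed

end

lemma (in sym_trilinear) sing_scale: "sing p \<Longrightarrow> k \<noteq> 0 \<Longrightarrow> sing (k *s p)"
  by (simp add: sing_def linear)

context real_cubic
begin

text \<open>If \<open>cnjv p = k *s p\<close>, then the real and imaginary parts of \<open>p\<close>
  are the multiples of \<open>p\<close> by \<open>1 + k\<close> and \<open>1 - k\<close>, up to
  nonzero constants, and these are not both zero.\<close>

lemma sing_cvec_of_cnjv_in_span:
  assumes p: "cx.sing p" and k: "cnjv p \<in> vec.span {p}"
  obtains v where "cx.sing (cvec v)"
proof -
  obtain k where k: "cnjv p = k *s p" using k by (auto simp: vec.span_singleton)
  have re: "cvec (Rev p) = ((1 + k) / 2) *s p" and im: "cvec (Imv p) = (- \<i> / 2 * (1 - k)) *s p"
    unfolding cvec_Rev cvec_Imv k by (simp_all add: vec_eq_iff field_simps)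
  show ?thesis
  proof (cases "k = 1")
    case True
    then have "cx.sing (cvec (Rev p))" unfolding re using p by (intro cx.sing_scale) auto
    then show ?thesis by (rule that)
  next
    case False
    then have "cx.sing (cvec (Imv p))" unfolding im using p by (intro cx.sing_scale) auto
    then show ?thesis by (rule that)
  qed
qed

lemma lin_indep_of_complex:
  assumes W: "vec.subspace W" "\<And>x. x \<in> W \<Longrightarrow> cnjv x \<in> W"
    and w: "w0 \<noteq> w1" "w0 \<noteq> w2" "w1 \<noteq> w2" "{cvec w0, cvec w1, cvec w2} \<subseteq> W"
      "vec.independent {cvec w0, cvec w1, cvec w2}"
    and p: "cnjv p \<notin> vec.span (insert p W)"
    and b: "b 0 = Rev p" "b 1 = Imv p" "b 2 = w0" "b 3 = w1" "b (4 :: 5) = w2"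
  shows "lin_indep b"
  unfolding lin_indep_def
proof (intro allI impI)
  fix a :: "5 \<Rightarrow> real" and i :: 5
  assume "(\<Sum>k\<in>UNIV. a k *s b k) = 0"
  then have "cvec (a 0 *s Rev p + a 1 *s Imv p + a 2 *s w0 + a 3 *s w1 + a 4 *s w2) = 0"
    by (simp add: sum_5 b)
  then have eq: "complex_of_real (a 0) *s cvec (Rev p) + complex_of_real (a 1) *s cvec (Imv p) +
      (complex_of_real (a 2) *s cvec w0 + complex_of_real (a 3) *s cvec w1 + complex_of_real (a 4) *s cvec w2) = 0"
    by (simp add: cvec_linear add.assoc)
  let ?w = "complex_of_real (a 2) *s cvec w0 + complex_of_real (a 3) *s cvec w1 + complex_of_real (a 4) *s cvec w2"
  \<comment> \<open>The coefficient of \<open>cnjv p\<close> in the given combination;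
    \<open>?k'\<close> is that of \<open>p\<close>. Since \<open>a 0\<close> and \<open>a 1\<close>
    are real, \<open>?k = 0\<close> already forces both to vanish.\<close>
  let ?k = "(complex_of_real (a 0) + \<i> * complex_of_real (a 1)) / 2"
  let ?k' = "(complex_of_real (a 0) - \<i> * complex_of_real (a 1)) / 2"
  have wW: "?w \<in> W" using W(1) w(4) by (auto intro!: vec.subspace_add vec.subspace_scale)
  have "?k *s cnjv p + (?k' *s p + ?w) = 0"
    using eq unfolding cvec_Rev cvec_Imv by (simp add: vec_eq_iff field_simps)
  moreover have "?k' *s p + ?w \<in> vec.span (insert p W)"
    using wW by (intro vec.span_add vec.span_scale vec.span_base) auto
  ultimately have "?k = 0" using p by (rule vec_coeff_zero)
  then have a01: "a 0 = 0" "a 1 = 0" by (simp_all add: complex_eq_iff)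
  have c: "cvec w0 \<noteq> cvec w1" "cvec w0 \<noteq> cvec w2" "cvec w1 \<noteq> cvec w2"
    using w(1-3) by (auto simp: vec_eq_iff cvec_def)
  have out: "cvec w0 \<notin> vec.span {cvec w1, cvec w2}" "cvec w1 \<notin> vec.span {cvec w0, cvec w2}"
      "cvec w2 \<notin> vec.span {cvec w0, cvec w1}"
  proof -
    have "x \<notin> vec.span ({cvec w0, cvec w1, cvec w2} - {x})" if "x \<in> {cvec w0, cvec w1, cvec w2}" for x
      using w(5) that by (auto simp: vec.dependent_def)
    from this[of "cvec w0"] this[of "cvec w1"] this[of "cvec w2"] c
    show "cvec w0 \<notin> vec.span {cvec w1, cvec w2}" "cvec w1 \<notin> vec.span {cvec w0, cvec w2}"
      "cvec w2 \<notin> vec.span {cvec w0, cvec w1}"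
      by (auto simp: insert_Diff_if)
  qed
  have mem: "r *s u + s *s v \<in> vec.span {u, v}" for r s and u v :: "complex ^ 5"
    by (intro vec.span_add vec.span_scale vec.span_base) auto
  have w0: "complex_of_real (a 2) *s cvec w0 + (complex_of_real (a 3) *s cvec w1 + complex_of_real (a 4) *s cvec w2) = 0"
    using eq a01 by (simp add: add.assoc)
  then have "complex_of_real (a 2) = 0" using mem out(1) by (rule vec_coeff_zero)
  moreover have "complex_of_real (a 3) *s cvec w1 + (complex_of_real (a 2) *s cvec w0 + complex_of_real (a 4) *s cvec w2) = 0"
    using w0 by (simp only: add_ac)
  then have "complex_of_real (a 3) = 0" using mem out(2) by (rule vec_coeff_zero)
  moreover have "complex_of_real (a 4) *s cvec w2 + (complex_of_real (a 2) *s cvec w0 + complex_of_real (a 3) *s cvec w1) = 0"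
    using w0 by (simp only: add_ac)
  then have "complex_of_real (a 4) = 0" using mem out(3) by (rule vec_coeff_zero)
  ultimately show "a i = 0"
    using a01 exhaust_5[of i] by auto
qed

lemma T_basis_zero:
  assumes "lin_indep b" "\<And>k. tc x y (b k) = 0"
  shows "TC (cvec x) (cvec y) z = 0"
proof (rule TC_cvec_eq_0)
  fix z
  obtain a where z: "z = (\<Sum>k\<in>UNIV. a k *s b k)" using basis_expand[OF assms(1)] .
  have "tc x y (\<Sum>k\<in>A. a k *s b k) = 0" for A
    by (induction A rule: infinite_finite_induct) (simp_all add: re.linear assms(2))
  then show "tc x y z = 0" unfolding z .
qed

text \<open>The line through \<open>b i\<close> and \<open>b j\<close> would consist of singular
  points.\<close>

lemma not_doubly_vanishing:
  assumes fin: "finite cx.singular_lines" and b: "lin_indep b" and ij: "i \<noteq> j"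
    and "\<And>k. tc (b i) (b i) (b k) = 0" "\<And>k. tc (b i) (b j) (b k) = 0" "\<And>k. tc (b j) (b j) (b k) = 0"
  shows False
proof (rule cx.no_singular_line[OF fin])
  have b0: "a k = 0" if "(\<Sum>k\<in>UNIV. a k *s b k) = 0" for a k
    using b that unfolding lin_indep_def by blast
  show "cvec (b i) \<noteq> 0"
    using b0[of "\<lambda>k. if k = i then 1 else 0" i]
    by (auto simp: if_distrib[of "\<lambda>a. a *s _"] cong: if_cong)
  show "cvec (b j) \<notin> vec.span {cvec (b i)}"
  proof
    assume "cvec (b j) \<in> vec.span {cvec (b i)}"
    then obtain k where k: "cvec (b j) = k *s cvec (b i)" by (auto simp: vec.span_singleton)
    then have "b j = Re k *s b i"
      by (simp add: vec_eq_iff cvec_def complex_eq_iff)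
    then have "(\<Sum>l\<in>UNIV. (if l = i then Re k else if l = j then - 1 else 0) *s b l) = 0"
      using ij by (simp add: if_distrib[of "\<lambda>a. a *s _"] sum.If_cases cong: if_cong)
    from b0[OF this, of j] ij show False by simp
  qed
qed (use assms in \<open>auto intro: T_basis_zero\<close>)

text \<open>All that the parametrizations need from the complex geometry: either a real singular
  point that is not the vertex of a cone, or a real basis adapted to the line (indices 0, 1) and the
  plane (indices 2, 3, 4). The last two conditions make \<open>T P w w\<close> and
  \<open>T P P w\<close> nonzero as forms.\<close>

lemma normal_form:
  assumes card: "card cx.singular_lines = 6"
    and uniq: "\<exists>!W. vec.subspace W \<and> vec.dim W = 3 \<and> (\<forall>x\<in>W. TC x x x = 0)"
  obtains (node) v w where "\<And>y. tc v v y = 0" "tc v w w \<noteq> 0"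
  | (line) b where "lin_indep b"
      "\<And>i j k. {i, j, k} \<subseteq> {0, 1} \<or> {i, j, k} \<subseteq> {2, 3, 4} \<Longrightarrow> tc (b i) (b j) (b k) = 0"
      "\<exists>i\<in>{0,1}. \<exists>j\<in>{2,3,4}. \<exists>k\<in>{2,3,4}. tc (b i) (b j) (b k) \<noteq> 0"
      "\<exists>i\<in>{0,1}. \<exists>j\<in>{0,1}. \<exists>k\<in>{2,3,4}. tc (b i) (b j) (b k) \<noteq> 0"
proof -
  have fin: "finite cx.singular_lines" using card by (metis card.infinite zero_neq_numeral)
  obtain W where W: "vec.subspace W" "vec.dim W = 3" "\<forall>x\<in>W. TC x x x = 0"
    using uniq by blast
  note cnjW = real_plane_basis(1)[OF uniq W]
  obtain p where p: "cx.sing p" "p \<notin> W"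
    using cx.singular_point_outside_plane[OF W(1,2) fin] card by auto
  show ?thesis
  proof (cases "cnjv p \<in> vec.span {p}")
    case True
    then obtain v where v: "cx.sing (cvec v)" by (rule sing_cvec_of_cnjv_in_span[OF p(1)])
    moreover obtain w where "tc v w w \<noteq> 0"
      using not_cone[OF fin _ v] card by auto
    ultimately show ?thesis using sing_cvec_imp node by blast
  next
    case False
    have q: "cx.sing (cnjv p)" "cnjv p \<notin> W"
      using sing_cnjv[OF p(1)] p(2) cnjW[of "cnjv p"] by auto
    have out: "cnjv p \<notin> vec.span (insert p W)"
    proof
      assume "cnjv p \<in> vec.span (insert p W)"
      then obtain V where "vec.subspace V" "vec.dim V = 3" "\<forall>x\<in>V. TC x x x = 0" "V \<noteq> W"
        by (rule second_plane[OF cx.sym_trilinear_axioms W p q _ False])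
      with uniq W show False by blast
    qed
    obtain w0 w1 w2 where w: "w0 \<noteq> w1" "w0 \<noteq> w2" "w1 \<noteq> w2" "{cvec w0, cvec w1, cvec w2} \<subseteq> W"
      "vec.independent {cvec w0, cvec w1, cvec w2}"
      using real_plane_basis(2)[OF uniq W] by blast
    define b :: "5 \<Rightarrow> real ^ 5" where
      "b i = (if i = 0 then Rev p else if i = 1 then Imv p else if i = 2 then w0 else if i = 3 then w1 else w2)" for i
    have b: "b 0 = Rev p" "b 1 = Imv p" "b 2 = w0" "b 3 = w1" "b 4 = w2"
      by (simp_all add: b_def)
    have indep: "lin_indep b"
      using lin_indep_of_complex[OF W(1) cnjW w out b] .
    have bL: "\<exists>r s. cvec (b i) = r *s p + s *s cnjv p" if "i \<in> {0, 1}" for i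
    proof -
      have "cvec (Rev p) = (1 / 2) *s p + (1 / 2) *s cnjv p"
        "cvec (Imv p) = (- \<i> / 2) *s p + (\<i> / 2) *s cnjv p"
        unfolding cvec_Rev cvec_Imv by (simp_all add: vec_eq_iff algebra_simps)
      with that show ?thesis by (metis b(1,2) insertE singletonD)
    qed
    have bW: "cvec (b i) \<in> W" if "i \<in> {2, 3, 4}" for i
      using that w(4) by (auto simp: b)
    have z: "tc (b i) (b j) (b k) = 0" if "{i, j, k} \<subseteq> {0, 1} \<or> {i, j, k} \<subseteq> {2, 3, 4}" for i j k
    proof -
      have "TC (cvec (b i)) (cvec (b j)) (cvec (b k)) = 0"
        using that
      proof
        \<comment> \<open>Among three arguments taken from \<open>p\<close> and
          \<open>cnjv p\<close> one occurs twice, and singularity of that point kills the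
          term.\<close>
        assume *: "{i, j, k} \<subseteq> {0, 1}"
        obtain r s where i: "cvec (b i) = r *s p + s *s cnjv p" using bL * by force
        obtain r' s' where j: "cvec (b j) = r' *s p + s' *s cnjv p" using bL * by force
        obtain r'' s'' where k: "cvec (b k) = r'' *s p + s'' *s cnjv p" using bL * by force
        have "TC p p y = 0" "TC (cnjv p) (cnjv p) y = 0" for y using p(1) q(1) by (auto simp: cx.sing_def)
        from this[of p] this[of "cnjv p"] show ?thesis
          unfolding i j k by (simp add: cx.linear cx.perms)
      next
        assume "{i, j, k} \<subseteq> {2, 3, 4}"
        then show ?thesis by (intro cx.polarize_subspace[OF W(1,3)] bW) auto
      qed
      then show ?thesis by (simp add: trilin_cvec)
    qed
    have sym: "tc (b i) (b j) (b k) = tc (b k) (b i) (b j)" for i j k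
      by (rule re.perms(4)[symmetric])
    have cases: "k \<in> {0, 1} \<or> k \<in> {2, 3, 4}" for k :: 5
      using exhaust_5[of k] by auto
    show ?thesis
    proof (rule line[OF indep z])
      \<comment> \<open>Otherwise all of the plane would be singular, in particular the line through
        \<open>b 2\<close> and \<open>b 3\<close>.\<close>
      show "\<exists>i\<in>{0,1}. \<exists>j\<in>{2,3,4}. \<exists>k\<in>{2,3,4}. tc (b i) (b j) (b k) \<noteq> 0"
      proof (rule ccontr)
        assume neg: "\<not> ?thesis"
        have "tc (b i) (b j) (b k) = 0" if "i \<in> {2, 3, 4}" "j \<in> {2, 3, 4}" for i j k
          using cases[of k]
        proof
          assume "k \<in> {0, 1}"
          with neg that show ?thesis unfolding sym[of i j k] by blast
        qed (use z[of i j k] that in auto)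
        then show False
          by (intro not_doubly_vanishing[OF fin indep, of 2 3]) auto
      qed
      show "\<exists>i\<in>{0,1}. \<exists>j\<in>{0,1}. \<exists>k\<in>{2,3,4}. tc (b i) (b j) (b k) \<noteq> 0"
      proof (rule ccontr)
        assume neg: "\<not> ?thesis"
        have "tc (b i) (b j) (b k) = 0" if "i \<in> {0, 1}" "j \<in> {0, 1}" for i j k
          using cases[of k]
        proof
          assume "k \<in> {2, 3, 4}"
          with neg that show ?thesis by blast
        qed (use z[of i j k] that in auto)
        then show False
          by (intro not_doubly_vanishing[OF fin indep, of 0 1]) auto
      qed
    qed
  qed
qed

end

section \<open>Birational maps to projective space\<close>

lemma (in coeff_hom) prod: "\<theta> (prod f A) = (\<Prod>i\<in>A. \<theta> (f i))"
  by (induction A rule: infinite_finite_induct) (auto simp: mult)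

lemma (in coeff_hom) power: "\<theta> (a ^ n) = \<theta> a ^ n"
  by (induction n) (auto simp: mult)

lemma subst_poly_single:
  "subst_poly \<phi> (Poly_Mapping.single m a) = Const a * (\<Prod>i\<in>UNIV. \<phi> i ^ Poly_Mapping.lookup m i)"
  by (simp add: subst_poly_def Const.eval_hom_single)

lemma subst_poly_subst_poly:
  "subst_poly \<psi> (subst_poly \<phi> p) = subst_poly (\<lambda>i. subst_poly \<psi> (\<phi> i)) p"
  by (induction p rule: mpoly_induct)
     (simp_all add: subst_poly.add subst_poly_single subst_poly.mult subst_poly.prod subst_poly.power)

lemma subst_poly_scale:
  assumes "homogeneous d p"
  shows "subst_poly (\<lambda>i. g * h i) p = g ^ d * subst_poly h p"
proof -
  have "subst_poly (\<lambda>i. g * h i) (Poly_Mapping.single m (Poly_Mapping.lookup p m)) =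
      g ^ d * subst_poly h (Poly_Mapping.single m (Poly_Mapping.lookup p m))"
    if "m \<in> Poly_Mapping.keys p" for m
  proof -
    have "(\<Prod>i\<in>UNIV. g ^ Poly_Mapping.lookup m i) = g ^ d"
      using assms that unfolding homogeneous_def by (metis power_sum)
    then show ?thesis
      by (simp add: subst_poly_single power_mult_distrib prod.distrib mult.left_commute)
  qed
  then have "subst_poly (\<lambda>i. g * h i) (\<Sum>m\<in>Poly_Mapping.keys p. Poly_Mapping.single m (Poly_Mapping.lookup p m))
     = g ^ d * subst_poly h (\<Sum>m\<in>Poly_Mapping.keys p. Poly_Mapping.single m (Poly_Mapping.lookup p m))"
    unfolding subst_poly.sum sum_distrib_left by (rule sum.cong[OF refl])
  then show ?thesis by (simp add: mpoly_sum_monomials)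
qed

lemma subst_poly_Var_id: "subst_poly Var p = p"
  by (induction p rule: mpoly_induct)
     (simp_all add: subst_poly.add subst_poly_single single_eq_Const_mult_prod[symmetric])

lemma Var_neq_0: "Var i \<noteq> (0 :: ('v, 'a::zero_neq_one) mpoly)"
  unfolding Var_def by (metis lookup_single_eq lookup_zero zero_neq_one)

text \<open>Reduces birationality to polynomial identities. Multiples of \<open>F\<close> are killed
  by \<open>subst_poly \<psi>\<close>, while the \<open>\<phi> i\<close> go to
  \<open>g * Var i\<close>, and the composite of \<psi> after \<phi> goes to \<open>g ^ e\<close>
  times \<psi>. This shows that neither \<phi> nor that composite vanishes on
  \<open>F = 0\<close>.\<close>

lemma birational_projective_spaceI:
  fixes F :: "('v::finite, 'a::field) mpoly" and \<phi> :: "'w::{finite,linorder} \<Rightarrow> ('v, 'a) mpoly"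
  assumes \<phi>: "\<And>i. homogeneous d (\<phi> i)" "d > 0" and \<psi>: "\<And>i. homogeneous e (\<psi> i)"
    and zero: "subst_poly \<psi> F = 0"
    and inv: "\<And>i. subst_poly \<psi> (\<phi> i) = g * Var i" "g \<noteq> 0"
    and cross: "\<And>i j. F dvd subst_poly \<phi> (\<psi> i) * Var j - subst_poly \<phi> (\<psi> j) * Var i"
  shows "birational F (0 :: ('w, 'a) mpoly)"
proof -
  have kill: "subst_poly \<psi> p = 0" if "F dvd p" for p
    using that zero by (auto simp: dvd_def subst_poly.mult)
  have nz: "g * Var i \<noteq> 0" for i :: 'w
    using inv(2) Var_neq_0[of i] by simp
  obtain m where m: "\<psi> m \<noteq> 0"
  proof (cases "\<forall>m. \<psi> m = 0")
    case True
    \<comment> \<open>Written as a product so that \<open>subst_poly_scale\<close> extracts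
      \<open>0 ^ d\<close>, which is zero because \<open>d > 0\<close>.\<close>
    then have \<psi>0: "\<psi> = (\<lambda>i. 0 * 0)" by (intro ext) simp
    have "subst_poly \<psi> (\<phi> undefined) = 0 ^ d * subst_poly (\<lambda>_. 0) (\<phi> undefined)"
      unfolding \<psi>0 by (rule subst_poly_scale[OF \<phi>(1)])
    also have "\<dots> = 0" using \<phi>(2) by simp
    finally have False using nz[of undefined] unfolding inv(1) by simp
    then show ?thesis ..
  qed (use that in blast)
  have "\<not> F dvd \<phi> i" for i
    using kill[of "\<phi> i"] nz[of i] unfolding inv(1) by blast
  then have 1: "rational_map F 0 \<phi>"
    unfolding rational_map_def using \<phi>(1) by auto
  have 2: "rational_map 0 F \<psi>"
    unfolding rational_map_def using \<psi> m zero by auto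
  have "subst_poly \<psi> (subst_poly \<phi> (\<psi> m)) = g ^ e * \<psi> m"
    unfolding subst_poly_subst_poly inv(1) subst_poly_scale[OF \<psi>] subst_poly_Var_id ..
  also have "\<dots> \<noteq> 0" using m inv(2) by simp
  finally have "\<not> F dvd comp_map \<psi> \<phi> m"
    using kill by (auto simp: comp_map_def)
  then have 3: "rational_inverse F \<phi> \<psi>"
    using cross by (auto simp: rational_inverse_def same_rational_map_def comp_map_def)
  have 4: "rational_inverse 0 \<psi> \<phi>"
    using nz by (auto simp: rational_inverse_def same_rational_map_def comp_map_def inv(1) mult_ac)
  show ?thesis unfolding birational_def using 1 2 3 4 by blast
qed

lemma tri_cube:
  assumes "symmetric_array C"
  shows "tri C (\<lambda>i. a * x i + e * y i) (\<lambda>i. a * x i + e * y i) (\<lambda>i. a * x i + e * y i)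
    = a ^ 3 * tri C x x x + 3 * a\<^sup>2 * e * tri C x x y + 3 * a * e\<^sup>2 * tri C x y y + e ^ 3 * tri C y y y"
proof -
  note s = tri_swap12[OF assms] tri_swap23[OF assms]
  have "tri C x y x = tri C x x y" "tri C y x x = tri C x x y" "tri C y x y = tri C x y y" "tri C y y x = tri C x y y"
    using s by metis+
  then show ?thesis
    by (simp add: tri_linear power2_eq_square power3_eq_cube algebra_simps)
qed

lemma homogeneous_tri:
  assumes "\<And>i. homogeneous a (x i)" "\<And>i. homogeneous b (y i)" "\<And>i. homogeneous e (z i)"
  shows "homogeneous (a + b + e) (tri (\<lambda>i j k. Const (c i j k)) x y z)"
  unfolding tri_def
  by (intro homogeneous_sum homogeneous_mult homogeneous_Const_mult assms)

lemma subst_poly_linear_form: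
  "subst_poly \<psi> (\<Sum>j\<in>UNIV. Const (d j) * Var j) = (\<Sum>j\<in>UNIV. Const (d j) * \<psi> j)"
  by (simp add: subst_poly.sum subst_poly.mult)

lemma homogeneous_linear_form: "homogeneous 1 (\<Sum>j\<in>UNIV. Const (d j) * Var j)"
  by (intro homogeneous_sum homogeneous_Const_mult homogeneous_Var)

section \<open>Explicit parametrizations by vectors of polynomials\<close>

context real_cubic
begin

abbreviation (input) kv :: "real ^ 5 \<Rightarrow> 5 \<Rightarrow> ('w, real) mpoly"
  where "kv x \<equiv> \<lambda>m. Const (x $ m)"

abbreviation TP :: "(5 \<Rightarrow> ('w, real) mpoly) \<Rightarrow> (5 \<Rightarrow> ('w, real) mpoly) \<Rightarrow> (5 \<Rightarrow> ('w, real) mpoly) \<Rightarrow> ('w, real) mpoly"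
  where "TP \<equiv> tri (\<lambda>i j k. Const (c i j k))"

lemma symmetric_Const: "symmetric_array (\<lambda>i j k. Const (c i j k))"
  using c by (simp add: symmetric_array_def)

lemma TP_kv: "TP (kv x) (kv y) (kv z) = Const (tc x y z)"
  by (simp add: trilin_def Const.tri)

lemma subst_poly_TP: "subst_poly \<phi> (TP x y z)
  = TP (\<lambda>m. subst_poly \<phi> (x m)) (\<lambda>m. subst_poly \<phi> (y m)) (\<lambda>m. subst_poly \<phi> (z m))"
  by (simp add: subst_poly.tri)

lemma eval_at_TP: "eval_at (TP x y z) u
  = tc (\<chi> m. eval_at (x m) u) (\<chi> m. eval_at (y m) u) (\<chi> m. eval_at (z m) u)"
proof -
  have [simp]: "($) (\<chi> m. f m) = f" for f :: "5 \<Rightarrow> real" by (rule ext) simp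
  show ?thesis unfolding eval_at.tri trilin_def by (simp add: eval_at_def)
qed

text \<open>The hypothesis speaks of real vectors only; a vector of polynomials is a combination of
  coordinate vectors with polynomial coefficients.\<close>

lemma TP_node:
  assumes "\<And>y. tc v v y = 0"
  shows "TP (kv v) (kv v) x = 0"
proof -
  have x: "x = (\<lambda>m. \<Sum>k\<in>UNIV. x k * kv (axis k 1) m)"
  proof
    fix m
    have "(\<Sum>k\<in>UNIV. x k * kv (axis k 1) m) = (\<Sum>k\<in>UNIV. if k = m then x m else 0)"
      by (intro sum.cong) (auto simp: axis_def)
    then show "x m = (\<Sum>k\<in>UNIV. x k * kv (axis k 1) m)" by simp
  qed
  have "TP (kv v) (kv v) (\<lambda>m. \<Sum>k\<in>A. x k * kv (axis k 1) m) = 0" for A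
  proof (induction A rule: infinite_finite_induct)
    case (insert k A)
    then show ?case by (simp add: tri_linear TP_kv assms)
  qed (simp_all add: tri_def)
  from this[of UNIV] show ?thesis unfolding x[symmetric] .
qed

end

locale real_cubic_coords = real_cubic +
  fixes b :: "5 \<Rightarrow> real ^ 5" and d :: "5 \<Rightarrow> 5 \<Rightarrow> real"
  assumes d: "(\<Sum>j\<in>UNIV. d i j * b k $ j) = (if i = k then 1 else 0)"
    and d': "(\<Sum>k\<in>UNIV. b k $ i * d k j) = (if i = j then 1 else 0)"
begin

text \<open>The coordinates with respect to the basis \<open>b\<close>, as linear forms.\<close>

definition \<xi> :: "5 \<Rightarrow> (5, real) mpoly" where "\<xi> i = (\<Sum>j\<in>UNIV. Const (d i j) * Var j)"

lemma homogeneous_\<xi>: "homogeneous 1 (\<xi> i)"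
  unfolding \<xi>_def by (rule homogeneous_linear_form)

lemma subst_\<xi>: "subst_poly \<psi> (\<xi> i) = (\<Sum>j\<in>UNIV. Const (d i j) * \<psi> j)"
  unfolding \<xi>_def by (rule subst_poly_linear_form)

lemma dual_kv: "(\<Sum>j\<in>UNIV. Const (d i j) * kv (b k) j) = (if i = k then 1 else 0)"
  by (simp only: Const.mult[symmetric] Const.sum[symmetric] d) simp

lemma Var_expand: "Var m = (\<Sum>k\<in>UNIV. \<xi> k * Const (b k $ m))"
proof -
  have "(\<Sum>k\<in>UNIV. \<xi> k * Const (b k $ m)) = (\<Sum>j\<in>UNIV. Const (\<Sum>k\<in>UNIV. b k $ m * d k j) * Var j)"
    unfolding \<xi>_def sum_distrib_right Const.sum Const.mult
    by (subst sum.swap) (simp add: mult_ac)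
  then show ?thesis
    unfolding d' by (simp add: if_distrib[of Const] if_distrib[of "\<lambda>a. a * _"] cong: if_cong)
qed

text \<open>Inverse of the projection from the node \<open>b\<^sub>0\<close>: since \<open>F (r b\<^sub>0 + s w) = 3 r s\<^sup>2 T b\<^sub>0 w w + s\<^sup>3 T w w w\<close>, the
  residual intersection of the line through \<open>b\<^sub>0\<close> and \<open>w\<close> has \<open>(r : s) = (- T w w w : 3 T b\<^sub>0 w w)\<close>.\<close>

lemma birational_node:
  assumes v: "\<And>y. tc (b 0) (b 0) y = 0" and w: "tc (b 0) w w \<noteq> 0"
    and lin: "lin_indep b"
  shows "birational (cubic_form c) (0 :: (4, real) mpoly)"
proof -
  \<comment> \<open>The general point of the hyperplane complementary to the node, which is the
    target of the projection. \<open>W'\<close> is the projection of the general point of the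
    source.\<close>
  define W :: "5 \<Rightarrow> (4, real) mpoly" where
    "W m = Var 1 * kv (b 1) m + (Var 2 * kv (b 2) m + (Var 3 * kv (b 3) m + Var 4 * kv (b 4) m))" for m
  define W' :: "5 \<Rightarrow> (5, real) mpoly" where
    "W' m = \<xi> 1 * kv (b 1) m + (\<xi> 2 * kv (b 2) m + (\<xi> 3 * kv (b 3) m + \<xi> 4 * kv (b 4) m))" for m
  define \<sigma> where "\<sigma> = TP (kv (b 0)) W W"
  define \<psi> where "\<psi> m = (- TP W W W) * kv (b 0) m + (3 * \<sigma>) * W m" for m
  \<comment> \<open>In the type \<open>4\<close> the numeral 4 equals 0, so the indices 1, 2, 3, 4
    exhaust it.\<close>
  define \<phi> :: "4 \<Rightarrow> (5, real) mpoly" where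
    "\<phi> i = (if i = 1 then \<xi> 1 else if i = 2 then \<xi> 2 else if i = 3 then \<xi> 3 else \<xi> 4)" for i
  have \<phi>: "\<phi> 1 = \<xi> 1" "\<phi> 2 = \<xi> 2" "\<phi> 3 = \<xi> 3" "\<phi> 4 = \<xi> 4"
    by (simp_all add: \<phi>_def)
  have node: "TP (kv (b 0)) (kv (b 0)) x = 0" for x :: "5 \<Rightarrow> ('u, real) mpoly"
    by (rule TP_node[OF v])
  have homW: "homogeneous 1 (W m)" for m
    unfolding W_def by (subst (1 2 3 4) mult.commute) (intro homogeneous_add homogeneous_Const_mult homogeneous_Var)
  have "homogeneous (0 + 1 + 1) \<sigma>"
    unfolding \<sigma>_def by (intro homogeneous_tri homW homogeneous_Const)
  then have hom\<sigma>: "homogeneous 2 \<sigma>" by (simp add: numeral_2_eq_2)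
  have "homogeneous (1 + 1 + 1) (TP W W W)" by (intro homogeneous_tri homW)
  then have homW3: "homogeneous 3 (TP W W W)" by (simp add: numeral_3_eq_3)
  show ?thesis
  \<comment> \<open>The coordinates of \<psi> along \<open>b 1\<close> to \<open>b 4\<close> are
    \<open>3 * \<sigma>\<close> times the variables, whence \<open>g\<close>.\<close>
  proof (rule birational_projective_spaceI[where \<phi> = \<phi> and \<psi> = \<psi> and g = "3 * \<sigma>" and d = 1 and e = 3])
    show "homogeneous 1 (\<phi> i)" for i by (simp add: \<phi>_def homogeneous_\<xi>[unfolded One_nat_def])
    show "homogeneous 3 (\<psi> m)" for m
    proof -
      have "homogeneous 3 ((- TP W W W) * kv (b 0) m)"
        by (subst mult.commute) (intro homogeneous_Const_mult homogeneous_uminus homW3)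
      moreover have "homogeneous 3 (Const 3 * (\<sigma> * W m))"
        using homogeneous_mult[OF hom\<sigma> homW] by (intro homogeneous_Const_mult) (simp add: numeral_3_eq_3)
      moreover have "Const 3 = (3 :: (4, real) mpoly)" by (simp add: Const_def)
      ultimately show ?thesis
        unfolding \<psi>_def by (intro homogeneous_add) (simp_all add: mult.assoc)
    qed
    show "subst_poly \<psi> (cubic_form c) = 0"
      unfolding subst_poly_TP subst_poly_Var \<psi>_def tri_cube[OF symmetric_Const]
      by (simp add: node \<sigma>_def[symmetric] power2_eq_square power3_eq_cube algebra_simps)
    show "subst_poly \<psi> (\<phi> i) = 3 * \<sigma> * Var i" for i
    proof -
      have "(\<Sum>j\<in>UNIV. Const (d l j) * \<psi> j) = (- TP W W W) * (\<Sum>j\<in>UNIV. Const (d l j) * kv (b 0) j)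
          + (3 * \<sigma>) * (Var 1 * (\<Sum>j\<in>UNIV. Const (d l j) * kv (b 1) j) + (Var 2 * (\<Sum>j\<in>UNIV. Const (d l j) * kv (b 2) j)
           + (Var 3 * (\<Sum>j\<in>UNIV. Const (d l j) * kv (b 3) j) + Var 4 * (\<Sum>j\<in>UNIV. Const (d l j) * kv (b 4) j))))" for l
        unfolding \<psi>_def W_def[of j for j] sum_distrib_left sum.distrib[symmetric]
        by (intro sum.cong refl) (simp add: algebra_simps)
      then have "subst_poly \<psi> (\<xi> l) = (- TP W W W) * (if l = 0 then 1 else 0) + (3 * \<sigma>) * (Var 1 * (if l = 1 then 1 else 0)
          + (Var 2 * (if l = 2 then 1 else 0) + (Var 3 * (if l = 3 then 1 else 0) + Var 4 * (if l = 4 then 1 else 0))))" for l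
        unfolding subst_\<xi> dual_kv by simp
      then show ?thesis
        using exhaust_4[of i] by (auto simp: \<phi>)
    qed
    show "3 * \<sigma> \<noteq> 0"
    proof
      assume "3 * \<sigma> = 0"
      moreover have "eval_at 3 u = 3" for u :: "real ^ 4"
        using eval_at.add[of 1 2 u] eval_at.add[of 1 1 u] by simp
      ultimately have 0: "eval_at \<sigma> u = 0" for u
        using eval_at.mult[of 3 \<sigma> u] by simp
      obtain a where a: "w = (\<Sum>k\<in>UNIV. a k *s b k)" using basis_expand[OF lin] .
      \<comment> \<open>The coordinates of \<open>w\<close> without the one along
        \<open>b 0\<close>; dropping that one does not change \<open>tc (b 0) w w\<close>, because
        \<open>b 0\<close> is singular.\<close>
      define u :: "real ^ 4" where "u = (\<chi> i. if i = 1 then a 1 else if i = 2 then a 2 else if i = 3 then a 3 else a 4)"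
      let ?w = "a 1 *s b 1 + a 2 *s b 2 + a 3 *s b 3 + a 4 *s b 4"
      have "eval_at (Var i) u = u $ i" "eval_at (Const x) u = x" for i x
        by (simp_all add: eval_at_def)
      then have "(\<chi> m. eval_at (W m) u) = ?w" "(\<chi> m. eval_at (kv (b 0) m) u) = b 0"
        by (simp_all add: W_def eval_at.add eval_at.mult u_def vec_eq_iff)
      then have "tc (b 0) ?w ?w = 0"
        using 0[of u] unfolding \<sigma>_def eval_at_TP by simp
      moreover have "w = a 0 *s b 0 + ?w" by (simp add: a sum_5 add.assoc)
      ultimately have "tc (b 0) w w = 0"
        using v re.swap23[of "b 0" ?w "b 0"] by (simp add: re.add2 re.add3 re.scale2 re.scale3 del: add.assoc)
      with w show False by simp
    qed
    have X: "Var = (\<lambda>m. \<xi> 0 * kv (b 0) m + 1 * W' m)"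
      by (rule ext) (subst Var_expand, simp add: sum_5 W'_def add.assoc)
    have W: "subst_poly \<phi> (W m) = W' m" for m
      by (simp add: W_def W'_def subst_poly.add subst_poly.mult \<phi>)
    define \<tau>' where "\<tau>' = TP W' W' W'"
    define \<sigma>' where "\<sigma>' = TP (kv (b 0)) W' W'"
    \<comment> \<open>Modulo the cubic, \<open>\<tau>'\<close> equals
      \<open>- 3 * \<xi> 0 * \<sigma>'\<close>, so \<psi> after \<phi> becomes
      \<open>3 * \<sigma>'\<close> times the identity.\<close>
    have F: "cubic_form c = 3 * \<xi> 0 * \<sigma>' + \<tau>'"
      unfolding X tri_cube[OF symmetric_Const] by (simp add: node \<sigma>'_def \<tau>'_def)
    have three: "subst_poly \<phi> 3 = 3"
      using subst_poly.add[of \<phi> 1 2] subst_poly.add[of \<phi> 1 1] by simp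
    have \<psi>\<phi>: "subst_poly \<phi> (\<psi> m) = - \<tau>' * kv (b 0) m + 3 * \<sigma>' * W' m" for m
      by (simp add: \<psi>_def subst_poly.diff subst_poly.mult subst_poly_TP W \<sigma>_def
          \<sigma>'_def \<tau>'_def three)
    show "cubic_form c dvd subst_poly \<phi> (\<psi> i) * Var j - subst_poly \<phi> (\<psi> j) * Var i" for i j
    proof
      show "subst_poly \<phi> (\<psi> i) * Var j - subst_poly \<phi> (\<psi> j) * Var i
          = cubic_form c * (W' i * kv (b 0) j - W' j * kv (b 0) i)"
        unfolding F \<psi>\<phi> by (subst (1 2) X) (simp add: algebra_simps)
    qed
  qed simp
qed

end

context real_cubic_coords
begin

lemma TP_line:
  assumes z: "\<And>i j k. {i, j, k} \<subseteq> {0, 1} \<or> {i, j, k} \<subseteq> {2, 3, 4} \<Longrightarrow> tc (b i) (b j) (b k) = 0"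
  shows "x = (\<lambda>m. r * kv (b 0) m + s * kv (b 1) m) \<Longrightarrow> TP x x x = 0"
    and "x = (\<lambda>m. r * kv (b 2) m + (s * kv (b 3) m + t * kv (b 4) m)) \<Longrightarrow> TP x x x = 0"
  by (simp_all add: tri_linear TP_kv z)

text \<open>For \<open>q i j k = T (b i) (b j) (b k)\<close> the displayed value is
  \<open>T P w w\<close> at \<open>P = b 0 + r b 1\<close> and
  \<open>w = b 2 + s b 3 + t b 4\<close>. The values at \<open>r = 0, 1\<close> and at six pairs
  \<open>(s, t)\<close> determine all coefficients.\<close>

lemma plane_quadric_nonzero:
  fixes q :: "5 \<Rightarrow> 5 \<Rightarrow> 5 \<Rightarrow> real"
  assumes q: "\<And>i j k. q i k j = q i j k"
    and nz: "\<exists>i\<in>{0,1}. \<exists>j\<in>{2,3,4}. \<exists>k\<in>{2,3,4}. q i j k \<noteq> 0"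
  obtains r s t where "(q 0 2 2 + 2 * s * q 0 2 3 + 2 * t * q 0 2 4 + s\<^sup>2 * q 0 3 3 + 2 * s * t * q 0 3 4 + t\<^sup>2 * q 0 4 4)
      + r * (q 1 2 2 + 2 * s * q 1 2 3 + 2 * t * q 1 2 4 + s\<^sup>2 * q 1 3 3 + 2 * s * t * q 1 3 4 + t\<^sup>2 * q 1 4 4) \<noteq> 0"
proof (rule ccontr)
  assume "\<not> thesis"
  with that have "\<forall>r s t. (q 0 2 2 + 2 * s * q 0 2 3 + 2 * t * q 0 2 4 + s\<^sup>2 * q 0 3 3 + 2 * s * t * q 0 3 4 + t\<^sup>2 * q 0 4 4)
      + r * (q 1 2 2 + 2 * s * q 1 2 3 + 2 * t * q 1 2 4 + s\<^sup>2 * q 1 3 3 + 2 * s * t * q 1 3 4 + t\<^sup>2 * q 1 4 4) = 0"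
    by blast
  note 0 = this[rule_format]
  have 1: "q i 2 2 + 2 * s * q i 2 3 + 2 * t * q i 2 4 + s\<^sup>2 * q i 3 3 + 2 * s * t * q i 3 4 + t\<^sup>2 * q i 4 4 = 0"
    if "i \<in> {0, 1}" for i s t
    using that 0[of s t 0] 0[of s t 1] by auto
  have "q i j k = 0" if i: "i \<in> {0, 1}" and jk: "j \<in> {2, 3, 4}" "k \<in> {2, 3, 4}" for i j k
  proof -
    note e = 1[OF i, of 0 0] 1[OF i, of 1 0] 1[OF i, of "- 1" 0] 1[OF i, of 0 1] 1[OF i, of 0 "- 1"] 1[OF i, of 1 1]
    have "q i 2 2 = 0" "q i 2 3 = 0" "q i 2 4 = 0" "q i 3 3 = 0" "q i 3 4 = 0" "q i 4 4 = 0"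
      using e by simp_all
    then show ?thesis using jk q[of i 3 2] q[of i 4 2] q[of i 4 3] by auto
  qed
  with nz show False by blast
qed

text \<open>For \<open>P\<close> on the line and \<open>w\<close> in the plane, \<open>F (r P + s w) = 3 r s (r T P P w + s T P w w)\<close>, so the
  join of \<open>P\<close> and \<open>w\<close> meets the cubic residually at \<open>(r : s) = (- T P w w : T P P w)\<close>. This parametrizes
  the cubic by the product of the line and the plane, which is birational to projective space via
  \<open>((y\<^sub>1 : y\<^sub>2), (y\<^sub>1 : y\<^sub>3 : y\<^sub>4))\<close>.\<close>

lemma birational_line:
  assumes z: "\<And>i j k. {i, j, k} \<subseteq> {0, 1} \<or> {i, j, k} \<subseteq> {2, 3, 4} \<Longrightarrow> tc (b i) (b j) (b k) = 0"
    and LPP: "\<exists>i\<in>{0,1}. \<exists>j\<in>{2,3,4}. \<exists>k\<in>{2,3,4}. tc (b i) (b j) (b k) \<noteq> 0"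
    and LLP: "\<exists>i\<in>{0,1}. \<exists>j\<in>{0,1}. \<exists>k\<in>{2,3,4}. tc (b i) (b j) (b k) \<noteq> 0"
  shows "birational (cubic_form c) (0 :: (4, real) mpoly)"
proof -
  define P :: "5 \<Rightarrow> (4, real) mpoly" where "P m = Var 1 * kv (b 0) m + Var 2 * kv (b 1) m" for m
  define W :: "5 \<Rightarrow> (4, real) mpoly" where
    "W m = Var 1 * kv (b 2) m + (Var 3 * kv (b 3) m + Var 4 * kv (b 4) m)" for m
  define P' :: "5 \<Rightarrow> (5, real) mpoly" where "P' m = \<xi> 0 * kv (b 0) m + \<xi> 1 * kv (b 1) m" for m
  define W' :: "5 \<Rightarrow> (5, real) mpoly" where
    "W' m = \<xi> 2 * kv (b 2) m + (\<xi> 3 * kv (b 3) m + \<xi> 4 * kv (b 4) m)" for m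
  define A where "A = TP P W W"
  define B where "B = TP P P W"
  define \<psi> where "\<psi> m = (- A) * P m + B * W m" for m
  \<comment> \<open>Chosen so that \<open>y\<^sub>1 : y\<^sub>2\<close> is the ratio of
    \<open>\<xi> 0\<close> to \<open>\<xi> 1\<close>, and
    \<open>y\<^sub>1 : y\<^sub>3 : y\<^sub>4\<close> is that of \<open>\<xi> 2\<close>,
    \<open>\<xi> 3\<close>, \<open>\<xi> 4\<close>.\<close>
  define \<phi> :: "4 \<Rightarrow> (5, real) mpoly" where
    "\<phi> i = (if i = 1 then \<xi> 0 * \<xi> 2 else if i = 2 then \<xi> 1 * \<xi> 2 else if i = 3 then \<xi> 0 * \<xi> 3 else \<xi> 0 * \<xi> 4)" for i
  have \<phi>: "\<phi> 1 = \<xi> 0 * \<xi> 2" "\<phi> 2 = \<xi> 1 * \<xi> 2" "\<phi> 3 = \<xi> 0 * \<xi> 3" "\<phi> 4 = \<xi> 0 * \<xi> 4"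
    by (simp_all add: \<phi>_def)
  have PPP: "TP P P P = 0" "TP P' P' P' = 0"
    by (rule TP_line(1)[OF z], auto simp: P_def P'_def)+
  have WWW: "TP W W W = 0" "TP W' W' W' = 0"
    by (rule TP_line(2)[OF z], auto simp: W_def W'_def)+
  have homP: "homogeneous 1 (P m)" and homW: "homogeneous 1 (W m)" for m
    unfolding P_def W_def mult.commute[of _ "Const _"]
    by (intro homogeneous_add homogeneous_Const_mult homogeneous_Var)+
  have homA: "homogeneous (1 + 1 + 1) A" and homB: "homogeneous (1 + 1 + 1) B"
    unfolding A_def B_def by (intro homogeneous_tri homP homW)+
  have eval: "eval_at (Var i) u = u $ i" "eval_at (Const x) u = x" for i x and u :: "real ^ 4"
    by (simp_all add: eval_at_def)
  have evalP: "(\<chi> m. eval_at (P m) u) = u $ 1 *s b 0 + u $ 2 *s b 1"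
    and evalW: "(\<chi> m. eval_at (W m) u) = u $ 1 *s b 2 + u $ 3 *s b 3 + u $ 4 *s b 4" for u
    by (simp_all add: P_def W_def eval_at.add eval_at.mult eval vec_eq_iff)
  have A: "A \<noteq> 0"
  proof
    assume "A = 0"
    then have 0: "tc (u $ 1 *s b 0 + u $ 2 *s b 1) (u $ 1 *s b 2 + u $ 3 *s b 3 + u $ 4 *s b 4)
        (u $ 1 *s b 2 + u $ 3 *s b 3 + u $ 4 *s b 4) = 0" for u :: "real ^ 4"
      using eval_at_TP[of P W W u] by (simp add: A_def evalP evalW)
    let ?q = "\<lambda>i j k. tc (b i) (b j) (b k)"
    have sym: "?q i k j = ?q i j k" for i j k by (rule re.swap23)
    obtain r s t where "(?q 0 2 2 + 2 * s * ?q 0 2 3 + 2 * t * ?q 0 2 4 + s\<^sup>2 * ?q 0 3 3 + 2 * s * t * ?q 0 3 4 + t\<^sup>2 * ?q 0 4 4)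
      + r * (?q 1 2 2 + 2 * s * ?q 1 2 3 + 2 * t * ?q 1 2 4 + s\<^sup>2 * ?q 1 3 3 + 2 * s * t * ?q 1 3 4 + t\<^sup>2 * ?q 1 4 4) \<noteq> 0"
      by (rule plane_quadric_nonzero[OF sym LPP])
    moreover have "tc (b 0 + r *s b 1) (b 2 + s *s b 3 + t *s b 4) (b 2 + s *s b 3 + t *s b 4) = 0"
      using 0[of "\<chi> i. if i = 1 then 1 else if i = 2 then r else if i = 3 then s else t"] by simp
    ultimately show False
      using sym[of 0 3 2] sym[of 0 4 2] sym[of 0 4 3] sym[of 1 3 2] sym[of 1 4 2] sym[of 1 4 3]
      by (simp add: re.linear power2_eq_square algebra_simps)
  qed
  have B: "B \<noteq> 0"
  proof
    assume "B = 0"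
    then have 0: "tc (u $ 1 *s b 0 + u $ 2 *s b 1) (u $ 1 *s b 0 + u $ 2 *s b 1)
        (u $ 1 *s b 2 + u $ 3 *s b 3 + u $ 4 *s b 4) = 0" for u :: "real ^ 4"
      using eval_at_TP[of P P W u] by (simp add: B_def evalP evalW)
    let ?q = "\<lambda>i j k. tc (b i) (b j) (b k)"
    have 1: "tc (b 0 + r *s b 1) (b 0 + r *s b 1) (b 2 + s *s b 3 + t *s b 4) = 0" for r s t
      using 0[of "\<chi> i. if i = 1 then 1 else if i = 2 then r else if i = 3 then s else t"] by simp
    have 2: "tc (b 0 + r *s b 1) (b 0 + r *s b 1) (b k) = 0" if "k \<in> {2, 3, 4}" for r k
      using that 1[of r 0 0] 1[of r 1 0] 1[of r 0 1] by (auto simp: re.add3)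
    have "?q i j k = 0" if k: "k \<in> {2, 3, 4}" and ij: "i \<in> {0, 1}" "j \<in> {0, 1}" for i j k
    proof -
      have "?q 0 0 k + 2 * r * ?q 0 1 k + r\<^sup>2 * ?q 1 1 k = 0" for r
        using 2[OF k, of r] re.swap12[of "b 1" "b 0" "b k"]
        by (simp add: re.linear power2_eq_square algebra_simps)
      from this[of 0] this[of 1] this[of "- 1"]
      have "?q 0 0 k = 0" "?q 0 1 k = 0" "?q 1 1 k = 0" by simp_all
      then show ?thesis using ij re.swap12[of "b 1" "b 0" "b k"] by auto
    qed
    with LLP show False by blast
  qed
  show ?thesis
  \<comment> \<open>On the image of \<psi> the line coordinates are \<open>- A\<close> times
    \<open>Var 1, Var 2\<close>, and the plane coordinates are \<open>B\<close> times
    \<open>Var 1, Var 3, Var 4\<close>. Each component of \<phi> multiplies one of either kind, one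
    of them with \<open>Var 1\<close>.\<close>
  proof (rule birational_projective_spaceI[where \<phi> = \<phi> and \<psi> = \<psi> and g = "- (A * B * Var 1)" and d = 2 and e = 4])
    show "homogeneous 2 (\<phi> i)" for i
    proof -
      have "homogeneous 2 (\<xi> k * \<xi> l)" for k l
        using homogeneous_mult[OF homogeneous_\<xi> homogeneous_\<xi>, of k l] by (simp only: one_add_one)
      then show ?thesis by (simp add: \<phi>_def)
    qed
    show "homogeneous 4 (\<psi> m)" for m
    proof -
      have "homogeneous (1 + 1 + 1 + 1) ((- A) * P m)" "homogeneous (1 + 1 + 1 + 1) (B * W m)"
        by (intro homogeneous_mult homogeneous_uminus homA homB homP homW)+
      moreover have "1 + 1 + 1 + 1 = (4 :: nat)" by simp
      ultimately show ?thesis unfolding \<psi>_def by (metis homogeneous_add)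
    qed
    show "subst_poly \<psi> (cubic_form c) = 0"
      unfolding subst_poly_TP subst_poly_Var \<psi>_def tri_cube[OF symmetric_Const]
      by (simp add: PPP WWW A_def[symmetric] B_def[symmetric] power2_eq_square)
    show "subst_poly \<psi> (\<phi> i) = - (A * B * Var 1) * Var i" for i
    proof -
      have "(\<Sum>j\<in>UNIV. Const (d l j) * \<psi> j) =
          (- A) * (Var 1 * (\<Sum>j\<in>UNIV. Const (d l j) * kv (b 0) j) + Var 2 * (\<Sum>j\<in>UNIV. Const (d l j) * kv (b 1) j))
          + B * (Var 1 * (\<Sum>j\<in>UNIV. Const (d l j) * kv (b 2) j)
           + (Var 3 * (\<Sum>j\<in>UNIV. Const (d l j) * kv (b 3) j) + Var 4 * (\<Sum>j\<in>UNIV. Const (d l j) * kv (b 4) j)))" for l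
        unfolding \<psi>_def P_def[of j for j] W_def[of j for j] sum_distrib_left sum.distrib[symmetric]
        by (intro sum.cong refl) (simp add: algebra_simps)
      then have "subst_poly \<psi> (\<xi> l) = (- A) * (Var 1 * (if l = 0 then 1 else 0) + Var 2 * (if l = 1 then 1 else 0))
          + B * (Var 1 * (if l = 2 then 1 else 0) + (Var 3 * (if l = 3 then 1 else 0) + Var 4 * (if l = 4 then 1 else 0)))" for l
        unfolding subst_\<xi> dual_kv by simp
      then show ?thesis
        using exhaust_4[of i] by (auto simp: \<phi> subst_poly.mult mult_ac)
    qed
    show "- (A * B * Var 1) \<noteq> 0"
      using A B Var_neq_0[of 1] by simp
    have X: "Var = (\<lambda>m. 1 * P' m + 1 * W' m)"
      by (rule ext) (subst Var_expand, simp add: sum_5 P'_def W'_def add.assoc)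
    have P: "subst_poly \<phi> (P m) = \<xi> 2 * P' m" for m
      by (simp add: P_def P'_def subst_poly.add subst_poly.mult \<phi> algebra_simps)
    have W: "subst_poly \<phi> (W m) = \<xi> 0 * W' m" for m
      by (simp add: W_def W'_def subst_poly.add subst_poly.mult \<phi> algebra_simps)
    define A' where "A' = TP P' W' W'"
    define B' where "B' = TP P' P' W'"
    \<comment> \<open>Modulo the cubic, \<open>B' = - A'\<close>, so
      \<open>B' * W' m - A' * P' m\<close> becomes \<open>- A'\<close> times the identity.\<close>
    have F: "cubic_form c = 3 * (A' + B')"
      unfolding X tri_cube[OF symmetric_Const] by (simp add: PPP WWW A'_def B'_def)
    have "subst_poly \<phi> A = \<xi> 2 * (\<xi> 0 * (\<xi> 0 * A'))" "subst_poly \<phi> B = \<xi> 2 * (\<xi> 2 * (\<xi> 0 * B'))"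
      by (simp_all add: A_def B_def subst_poly_TP P W tri_linear A'_def B'_def)
    then have \<psi>\<phi>: "subst_poly \<phi> (\<psi> m) = (\<xi> 0)\<^sup>2 * (\<xi> 2)\<^sup>2 * (B' * W' m - A' * P' m)" for m
      by (simp add: \<psi>_def subst_poly.diff subst_poly.mult P W power2_eq_square algebra_simps)
    have three: "(3 :: (5, real) mpoly) * Const (1 / 3) = 1"
    proof -
      have "(3 :: (5, real) mpoly) = Const 3" by (simp add: Const_def)
      moreover have "Const 3 * Const (1 / 3) = (1 :: (5, real) mpoly)"
        unfolding Const.mult[symmetric] by simp
      ultimately show ?thesis by (simp only:)
    qed
    \<comment> \<open>Divisibility by the cubic needs \<open>A' + B'\<close> as a multiple of it,
      hence the inverse of 3.\<close>
    have "cubic_form c * Const (1 / 3) = (3 * Const (1 / 3)) * (A' + B')"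
      unfolding F by (simp only: mult_ac)
    then have third: "cubic_form c * Const (1 / 3) = A' + B'"
      unfolding three by simp
    show "cubic_form c dvd subst_poly \<phi> (\<psi> i) * Var j - subst_poly \<phi> (\<psi> j) * Var i" for i j
    proof
      have "subst_poly \<phi> (\<psi> i) * Var j - subst_poly \<phi> (\<psi> j) * Var i
          = (A' + B') * ((\<xi> 0)\<^sup>2 * (\<xi> 2)\<^sup>2 * (P' j * W' i - P' i * W' j))"
        unfolding \<psi>\<phi> by (subst (1 2) X) (simp add: algebra_simps)
      then show "subst_poly \<phi> (\<psi> i) * Var j - subst_poly \<phi> (\<psi> j) * Var i
          = cubic_form c * (Const (1 / 3) * ((\<xi> 0)\<^sup>2 * (\<xi> 2)\<^sup>2 * (P' j * W' i - P' i * W' j)))"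
        unfolding third[symmetric] by (simp only: mult.assoc)
    qed
  qed simp
qed

end

section \<open>Choice of coordinates, irreducibility and conclusion\<close>

context real_cubic
begin

lemma coords:
  assumes "lin_indep b"
  obtains d where "real_cubic_coords c b d"
proof -
  obtain d where "\<forall>i k. (\<Sum>j\<in>UNIV. d i j * b k $ j) = (if i = k then 1 else 0)"
    "\<forall>i j. (\<Sum>k\<in>UNIV. b k $ i * d k j) = (if i = j then 1 else 0)"
    by (rule dual_basis[OF assms])
  then have "real_cubic_coords c b d" by unfold_locales auto
  then show ?thesis by (rule that)
qed

text \<open>Exchange: \<open>v\<close> replaces a coordinate vector along which it has a nonzero
  entry, and the transposition reindexes the others so that \<open>v\<close> stands at
  \<open>k0\<close>.\<close>

lemma extend_to_basis:
  fixes v :: "'a::field ^ 'n::finite" and k0 :: 'n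
  assumes "v \<noteq> 0"
  obtains b where "lin_indep b" "b k0 = v"
proof -
  obtain l where l: "v $ l \<noteq> 0" using assms by (auto simp: vec_eq_iff)
  let ?t = "Transposition.transpose k0 l"
  define b where "b k = (if k = k0 then v else axis (?t k) 1)" for k
  have "lin_indep b"
    unfolding lin_indep_def
  proof (intro allI impI)
    fix a i assume 0: "(\<Sum>k\<in>UNIV. a k *s b k) = 0"
    have *: "a k0 * v $ m + (\<Sum>k\<in>UNIV - {k0}. if k = ?t m then a k else 0) = 0" for m
    proof -
      have "0 = (\<Sum>k\<in>UNIV. a k *s b k) $ m" unfolding 0 by simp
      also have "\<dots> = a k0 * b k0 $ m + (\<Sum>k\<in>UNIV - {k0}. a k * b k $ m)"
        by (simp add: sum.remove[of UNIV k0])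
      also have "(\<Sum>k\<in>UNIV - {k0}. a k * b k $ m) = (\<Sum>k\<in>UNIV - {k0}. if k = ?t m then a k else 0)"
        by (intro sum.cong) (auto simp: b_def axis_def transpose_def split: if_splits)
      finally show ?thesis by (simp add: b_def)
    qed
    \<comment> \<open>In coordinate \<open>l\<close> only \<open>v\<close> contributes, since the
      index \<open>?t l = k0\<close> is excluded from the sum.\<close>
    have "a k0 = 0" using *[of l] l by (simp add: sum.delta')
    then show "a i = 0" using *[of "?t i"] by (cases "i = k0") (simp_all add: sum.delta')
  qed
  then show ?thesis by (rule that) (simp add: b_def)
qed

lemma irreducible_cubic_form:
  assumes nz: "cubic_form c \<noteq> 0" and hom: "homogeneous 3 (cubic_form c)"
    and uniq: "\<exists>!W. vec.subspace W \<and> vec.dim W = 3 \<and> (\<forall>x\<in>W. TC x x x = 0)"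
  shows "irreducible (cubic_form c)"
  using nz hom
proof (rule cubic_irreducible_or_linear_factor)
  fix l :: "5 \<Rightarrow> real" and H
  assume F: "cubic_form c = (\<Sum>i\<in>UNIV. Const (l i) * Var i) * H"
  let ?K = "{x :: complex ^ 5. (\<Sum>i\<in>UNIV. complex_of_real (l i) * x $ i) = 0}"
  have K: "TC x x x = 0" if "x \<in> ?K" for x
  proof -
    have "TC x x x = eval_at (complexify (cubic_form c)) x"
      by (simp add: complexify_cubic_form eval_at_cubic_form)
    also have "\<dots> = (\<Sum>i\<in>UNIV. complex_of_real (l i) * x $ i) * eval_at (complexify H) x"
      unfolding F by (simp add: complexify.mult complexify.sum eval_at.mult eval_at.sum) (simp add: eval_at_def)
    finally show ?thesis using that by simp
  qed
  have "3 < vec.dim ?K" using vec_dim_hyperplane(2)[of "\<lambda>i. complex_of_real (l i)"] by simp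
  then obtain U V where "vec.subspace U" "vec.subspace V" "vec.dim U = 3" "vec.dim V = 3"
    "U \<subseteq> ?K" "V \<subseteq> ?K" "U \<noteq> V"
    by (rule two_subspaces_of_subspace[OF vec_dim_hyperplane(1)]) simp
  with K uniq show ?thesis by blast
qed

end

theorem proposition5p3:
  fixes F :: "(5, real) mpoly"
  assumes cubic: "F \<noteq> 0" "homogeneous 3 F"
    and six_A1: "has_six_A1_singularities (complexify F)"
    and one_plane: "\<exists>!W. W \<in> linear_subspaces_in (complexify F) 2"
  shows "rational_threefold F"
proof -
  obtain c where c: "symmetric_array c" and F: "F = cubic_form c"
    by (rule homogeneous_3_imp_cubic_form[OF cubic(2)])
  interpret real_cubic c by standard (rule c)
  have "card (singular_points (complexify F)) = 6"
    using six_A1 by (simp add: has_six_A1_singularities_def)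
  then have six: "card cx.singular_lines = 6"
    unfolding F complexify_cubic_form singular_points_cubic_form[OF C]
      cx.singular_lines_def cx.sing_def .
  have uniq: "\<exists>!W. vec.subspace W \<and> vec.dim W = 3 \<and> (\<forall>x\<in>W. TC x x x = 0)"
    using one_plane by (simp add: F complexify_cubic_form linear_subspaces_cubic_form)
  have "birational F (0 :: (4, real) mpoly)"
    using six uniq
  proof (cases rule: normal_form)
    case (node v w)
    have "v \<noteq> 0" using node(2) by auto
    then obtain b :: "5 \<Rightarrow> real ^ 5" where b: "lin_indep b" "b 0 = v" by (rule extend_to_basis)
    obtain d where "real_cubic_coords c b d" by (rule coords[OF b(1)])
    then interpret real_cubic_coords c b d .
    show ?thesis unfolding F by (rule birational_node[OF _ _ b(1)]) (use node b in auto)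
  next
    case (line b)
    obtain d where "real_cubic_coords c b d" by (rule coords[OF line(1)])
    then interpret real_cubic_coords c b d .
    show ?thesis unfolding F by (rule birational_line[OF line(2-)])
  qed
  moreover have "irreducible F"
    using irreducible_cubic_form[OF _ _ uniq] cubic by (simp add: F)
  ultimately show ?thesis by (simp add: rational_threefold_def)
qed

end
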